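(* For any $\alpha\in[0,1]$ and any adversarial bandit problem with $K$ arms, the pseudo-regret of $\alpha$-Tsallis-INF with symmetric regularizer ($\xi_i=1$ for all $i$), learning rate $$\eta_t=\sqrt{\frac{K^{1-2\alpha}-K^{-\alpha}}{1-\alpha}\cdot\frac{1-t^{-\alpha}}{\alpha t}},$$ and importance-weighted (IW) loss estimators satisfies at any time $T$ $$\overline{Reg}_T\le 2\sqrt{\min\left\{\frac{1}{\alpha-\alpha^2},\frac{\log(K)}{\alpha},\frac{\log(T)}{1-\alpha}\right\}KT}+1.$$ (At the boundaries $\alpha=0$ and $\alpha=1$ the learning rates are defined by the limits $\lim_{\alpha\to0}\eta_t=\sqrt{\frac{(K-1)\log(t)}{t}}$ and $\lim_{\alpha\to1}\eta_t=\sqrt{\frac{\log(K)(1-t^{-1})}{t}}$, respectively.)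
   Context: Bandit setting. There are $K$ arms. In each round $t=1,2,\dots$ the environment picks a loss vector $\ell_t\in[0,1]^K$ and the agent chooses an arm $I_t\in\{1,\dots,K\}$; the agent observes and suffers only $\ell_{t,I_t}$. In the (adaptive) adversarial setting the losses $\ell_t$ are chosen arbitrarily, possibly depending on the agent's past actions $I_1,\dots,I_{t-1}$ and the adversary's own internal randomization (but not on $I_t$). The pseudo-regret is $\overline{Reg}_T=\mathbb{E}[\sum_{t=1}^T\ell_{t,I_t}]-\min_i\mathbb{E}[\sum_{t=1}^T\ell_{t,i}]$, with expectation over the randomization of both the algorithm and the environment. $\log$ is the natural logarithm; $\Delta^{K-1}$ is the probability simplex in $\mathbb{R}^K$. Algorithm ($\alpha$-Tsallis-INF, symmetric regularizer). For $\alpha\in(0,1)$ let $\Psi(w)=-\sum_{i=1}^K\frac{w_i^\alpha-\alpha w_i}{\alpha(1-\alpha)}$; for $\alpha\in\{0,1\}$ one uses the limits obtained after adding the constant $\frac{1}{\alpha}$ per coordinate (i.e. of $-\sum_i\frac{w_i^\alpha-\alpha w_i-(1-\alpha)}{\alpha(1-\alpha)}$): $\Psi(w)=-\sum_i(\log w_i-w_i+1)$ for $\alpha=0$ and $\Psi(w)=\sum_i(w_i\log w_i-w_i+1)$ for $\alpha=1$. Put $\Psi_t=\Psi/\eta_t$ and $\hat L_0=0$. In each round $t$: let $w_t=\arg\max_{w\in\Delta^{K-1}}\{\langle w,-\hat L_{t-1}\rangle-\Psi_t(w)\}$ (when $\eta_t=0$, as at $t=1$, $w_t$ is understood as the minimizer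 of $\Psi$ over $\Delta^{K-1}$, i.e. the uniform distribution); sample $I_t\sim w_t$; observe $\ell_{t,I_t}$; set $\hat\ell_{t,i}=\frac{\mathbf 1[I_t=i]\ell_{t,i}}{w_{t,i}}$ (the (IW) estimator) and $\hat L_t=\hat L_{t-1}+\hat\ell_t$. In the bound, terms of the minimum with zero denominator are read as $+\infty$.
   Formalization: At α=1 the learning rate is the actual limit sqrt(log(K)(1-1/t)/(Kt)) of the given formula; the displayed value sqrt(log(K)(1-1/t)/t) omits a factor 1/K under the root and is not the limit for K≥2, t≥2. *)

theory Defs
  imports "HOL-Probability.Probability" "HOL-Real_Asymp.Real_Asymp"
begin

text \<open>
  Arms are the elements of a finite type \<open>'k\<close>, so the number of arms is \<open>CARD('k)\<close>, and loss
  vectors, weights and cumulative loss estimates live in \<open>real ^ 'k\<close>.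
\<close>

definition prob_simplex :: "(real ^ 'k) set" where
  "prob_simplex = {w. (\<forall>i. 0 \<le> w $ i) \<and> (\<Sum>i\<in>UNIV. w $ i) = 1}"

text \<open>
  The case \<open>\<alpha> = 0\<close> is the log-barrier, which is infinite on the boundary of the simplex; this has to
  be said explicitly because \<open>ln 0 = 0\<close> in HOL. For \<open>\<alpha> = 1\<close> and \<open>0 < \<alpha> < 1\<close> the conventions
  \<open>0 * ln 0 = 0\<close> and \<open>0 powr \<alpha> = 0\<close> give the right boundary values.
\<close>

definition tsallis_reg :: "real \<Rightarrow> real ^ 'k \<Rightarrow> ereal" where
  "tsallis_reg \<alpha> w =
     (if \<alpha> = 0 then
        (if \<exists>i. w $ i = 0 then \<infinity> else ereal (- (\<Sum>i\<in>UNIV. ln (w $ i) - w $ i + 1)))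
      else if \<alpha> = 1 then
        ereal (\<Sum>i\<in>UNIV. w $ i * ln (w $ i) - w $ i + 1)
      else
        ereal (- (\<Sum>i\<in>UNIV. ((w $ i) powr \<alpha> - \<alpha> * (w $ i)) / (\<alpha> * (1 - \<alpha>)))))"

definition tsallis_weights :: "real \<Rightarrow> real \<Rightarrow> real ^ 'k \<Rightarrow> real ^ 'k" where
  "tsallis_weights \<alpha> \<eta> L =
     (if \<eta> = 0 then arg_min_on (tsallis_reg \<alpha>) prob_simplex
      else arg_max_on (\<lambda>w. ereal (w \<bullet> (- L)) - tsallis_reg \<alpha> w / ereal \<eta>) prob_simplex)"

definition learning_rate_interior :: "real \<Rightarrow> real \<Rightarrow> real \<Rightarrow> real" where
  "learning_rate_interior K t \<alpha> =
     sqrt ((K powr (1 - 2 * \<alpha>) - K powr (- \<alpha>)) / (1 - \<alpha>) * ((1 - t powr (- \<alpha>)) / (\<alpha> * t)))"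

definition learning_rate :: "real \<Rightarrow> real \<Rightarrow> nat \<Rightarrow> real" where
  "learning_rate \<alpha> K t =
     (if \<alpha> = 0 then Lim (at_right 0) (learning_rate_interior K (real t))
      else if \<alpha> = 1 then Lim (at_left 1) (learning_rate_interior K (real t))
      else learning_rate_interior K (real t) \<alpha>)"

lemma learning_rate_0:
  assumes "K \<ge> 1" "t \<ge> 1"
  shows "learning_rate 0 K t = sqrt ((K - 1) * ln (real t) / real t)"
proof -
  define x where "x = real t"
  have x: "x > 0" and K: "K > 0" using assms by (auto simp: x_def)
  have "((\<lambda>a. (K powr (1 - 2 * a) - K powr (- a)) / (1 - a) * ((1 - x powr (- a)) / (a * x)))
          \<longlongrightarrow> (K - 1) * ln x / x) (at_right 0)"
    using x K by (real_asymp simp: field_simps)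
  then have "(learning_rate_interior K x \<longlongrightarrow> sqrt ((K - 1) * ln x / x)) (at_right 0)"
    unfolding learning_rate_interior_def by (rule tendsto_real_sqrt)
  then show ?thesis
    by (simp add: learning_rate_def tendsto_Lim x_def)
qed

text \<open>
  The left limit at \<open>\<alpha> = 1\<close> carries a factor \<open>1 / K\<close>, i.e. it is the usual Exp3 scaling.
\<close>

lemma learning_rate_1:
  assumes "K \<ge> 1" "t \<ge> 1"
  shows "learning_rate 1 K t = sqrt (ln K * (1 - 1 / real t) / (K * real t))"
proof -
  define x where "x = real t"
  have x: "x > 0" and K: "K > 0" using assms by (auto simp: x_def)
  have "((\<lambda>a. (K powr (1 - 2 * a) - K powr (- a)) / (1 - a) * ((1 - x powr (- a)) / (a * x)))
          \<longlongrightarrow> ln K * (1 - 1 / x) / (K * x)) (at_left 1)"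
    using x K by (real_asymp simp: field_simps exp_minus)
  then have "(learning_rate_interior K x \<longlongrightarrow> sqrt (ln K * (1 - 1 / x) / (K * x))) (at_left 1)"
    unfolding learning_rate_interior_def by (rule tendsto_real_sqrt)
  then show ?thesis
    by (simp add: learning_rate_def tendsto_Lim x_def)
qed

text \<open>The importance-weighted estimate of a loss vector from the observed loss \<open>x\<close> of arm \<open>i\<close>.\<close>

definition iw_estimate :: "real ^ 'k \<Rightarrow> 'k \<Rightarrow> real \<Rightarrow> real ^ 'k" where
  "iw_estimate w i x = (\<chi> j. (if i = j then x else 0) / w $ j)"

text \<open>
  One run of the algorithm, for a fixed realisation of the arms \<open>a 1, a 2, \<dots>\<close> and of the observed
  losses \<open>x 1, x 2, \<dots>\<close>; rounds are numbered from 1. \<open>cum_estimate \<alpha> a x t\<close> depends only on the values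
  of \<open>a\<close> and \<open>x\<close> in rounds \<open>1, \<dots>, t\<close>.
\<close>

primrec cum_estimate :: "real \<Rightarrow> (nat \<Rightarrow> 'k) \<Rightarrow> (nat \<Rightarrow> real) \<Rightarrow> nat \<Rightarrow> real ^ 'k" where
  "cum_estimate \<alpha> a x 0 = 0"
| "cum_estimate \<alpha> a x (Suc t) =
     cum_estimate \<alpha> a x t +
     iw_estimate
       (tsallis_weights \<alpha> (learning_rate \<alpha> (real CARD('k)) (Suc t)) (cum_estimate \<alpha> a x t))
       (a (Suc t)) (x (Suc t))"

definition tsallis_inf_weights ::
    "real \<Rightarrow> (nat \<Rightarrow> 'k) \<Rightarrow> (nat \<Rightarrow> real) \<Rightarrow> nat \<Rightarrow> real ^ 'k" where
  "tsallis_inf_weights \<alpha> a x t =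
     tsallis_weights \<alpha> (learning_rate \<alpha> (real CARD('k)) t) (cum_estimate \<alpha> a x (t - 1))"

text \<open>
  The interaction with an adaptive adversary, on an arbitrary probability space carrying the
  randomness of both sides. \<open>F t\<close> is everything determined before arm \<open>t\<close> is drawn: it contains the
  losses of rounds \<open>1, \<dots>, t\<close>, the arms of rounds \<open>1, \<dots>, t - 1\<close>, and any internal randomness the
  adversary has used, but not arm \<open>t\<close>.
\<close>

locale bandit_game = prob_space M + filtration "space M" F
  for M :: "'a measure" and F :: "nat \<Rightarrow> 'a measure" +
  fixes loss :: "nat \<Rightarrow> 'a \<Rightarrow> real ^ ('k::finite)"
    and arm :: "nat \<Rightarrow> 'a \<Rightarrow> 'k"
  assumes subalgebra_F: "\<And>t. subalgebra M (F t)"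
    and loss_measurable: "\<And>t. t \<ge> 1 \<Longrightarrow> loss t \<in> borel_measurable (F t)"
    and loss_bounds: "\<And>t \<omega> i. t \<ge> 1 \<Longrightarrow> \<omega> \<in> space M \<Longrightarrow> loss t \<omega> $ i \<in> {0..1}"
    and arm_measurable: "\<And>t. t \<ge> 1 \<Longrightarrow> arm t \<in> measurable (F (Suc t)) (count_space UNIV)"

text \<open>
  The agent runs the algorithm: conditionally on \<open>F t\<close>, arm \<open>t\<close> has distribution \<open>w\<^sub>t\<close>, where \<open>w\<^sub>t\<close> is
  computed from the past arms and their observed losses only.
\<close>

locale tsallis_inf_game = bandit_game M F loss arm
  for M :: "'a measure" and F :: "nat \<Rightarrow> 'a measure"
    and loss :: "nat \<Rightarrow> 'a \<Rightarrow> real ^ ('k::finite)" and arm :: "nat \<Rightarrow> 'a \<Rightarrow> 'k" +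
  fixes \<alpha> :: real
  assumes arm_distribution: "\<And>t i. t \<ge> 1 \<Longrightarrow>
    AE \<omega> in M. real_cond_exp M (F t) (indicator {\<omega> \<in> space M. arm t \<omega> = i}) \<omega> =
      tsallis_inf_weights \<alpha> (\<lambda>s. arm s \<omega>) (\<lambda>s. loss s \<omega> $ arm s \<omega>) t $ i"

definition pseudo_regret ::
    "'a measure \<Rightarrow> (nat \<Rightarrow> 'a \<Rightarrow> real ^ 'k) \<Rightarrow> (nat \<Rightarrow> 'a \<Rightarrow> 'k) \<Rightarrow> nat \<Rightarrow> real" where
  "pseudo_regret M loss arm T =
     (\<integral>\<omega>. (\<Sum>t=1..T. loss t \<omega> $ arm t \<omega>) \<partial>M) -
     Min (range (\<lambda>i. \<integral>\<omega>. (\<Sum>t=1..T. loss t \<omega> $ i) \<partial>M))"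

text \<open>Quotient that is read as \<open>\<infinity>\<close> whenever the denominator vanishes, including \<open>0 / 0\<close>.\<close>

definition quot_inf :: "real \<Rightarrow> real \<Rightarrow> ereal" where
  "quot_inf a b = (if b = 0 then \<infinity> else ereal (a / b))"

text \<open>
  For every \<open>\<alpha>\<close> at least one of the denominators is nonzero, so the minimum below is finite and
  \<open>real_of_ereal\<close> loses nothing.
\<close>

definition regret_factor :: "real \<Rightarrow> nat \<Rightarrow> nat \<Rightarrow> real" where
  "regret_factor \<alpha> K T =
     real_of_ereal
       (min (quot_inf 1 (\<alpha> - \<alpha>\<^sup>2))
         (min (quot_inf (ln (real K)) \<alpha>) (quot_inf (ln (real T)) (1 - \<alpha>))))"

end

theory Submission
  imports Defs
begin

text \<open>
  The regularizer is separable with coordinate potential \<open>\<psi>\<close>, \<open>\<psi>' = qlog (\<alpha> - 1)\<close> and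
  \<open>\<psi>''(z) = z powr (\<alpha> - 2)\<close>, uniformly in \<open>\<alpha> \<in> [0,1]\<close>. First-order optimality of \<open>w\<^sub>t\<close> gives a
  Bregman gap for the FTRL objective. An importance-weighted estimate lives on one
  coordinate, where \<open>\<psi>''\<close> is decreasing, so the stability term of round \<open>t\<close> is at most
  \<open>\<eta>\<^sub>t / 2 * w\<^sub>t\<^sub>,\<^sub>I powr (- \<alpha>)\<close>, whose conditional expectation is at most \<open>\<eta>\<^sub>t / 2 * K powr \<alpha>\<close>.
  Comparing with the vertex \<open>i\<close> mixed with weight \<open>1 / T\<close> of the uniform distribution costs \<open>1\<close> and
  bounds the penalty by \<open>qlog (- \<alpha>) T * qlog (1 - \<alpha>) K / \<eta>\<^sub>T\<close>.

  The learning rate is not monotone: it vanishes in round 1 and, for small \<open>\<alpha>\<close>, increases once more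
  from round 2 to round 3. An increase by a factor \<open>\<rho>\<close> after round \<open>t\<close> costs at most \<open>\<rho> - 1\<close> times the
  estimated cumulative loss of the uniform distribution, and the slack in
  \<open>(\<Sum>t=3..T. 1 / (2 * sqrt t)) \<le> sqrt T - sqrt 2\<close> absorbs it.
\<close>

section \<open>The coordinate potential\<close>

text \<open>The Box-Cox (deformed) logarithm: the antiderivative of \<open>x powr (a - 1)\<close> on
  the positive reals that vanishes at 1. Including its limit \<open>a = 0\<close> lets \<alpha> = 0
  and \<alpha> = 1 share most proofs with the interior case.\<close>

definition qlog :: "real \<Rightarrow> real \<Rightarrow> real" where
  "qlog a x = (if a = 0 then ln x else (x powr a - 1) / a)"

lemma qlog_1 [simp]: "qlog a 1 = 0"
  by (simp add: qlog_def)

lemma DERIV_qlog: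
  assumes "x > 0"
  shows "(qlog a has_real_derivative x powr (a - 1)) (at x)"
proof (cases "a = 0")
  case True
  then show ?thesis
    using assms by (auto simp: qlog_def [abs_def] powr_minus_divide divide_inverse intro!: derivative_eq_intros)
next
  case False
  then show ?thesis
    using assms by (auto simp: qlog_def [abs_def] intro!: derivative_eq_intros)
qed

text \<open>Concavity: for a \<le> 1 the derivative \<open>x powr (a - 1)\<close> is nonincreasing,
  so the mean value theorem on either side of x keeps the graph below the tangent.\<close>

lemma qlog_tangent:
  assumes "a \<le> 1" "x > 0" "y > 0"
  shows "qlog a y \<le> qlog a x + x powr (a - 1) * (y - x)"
proof (cases x y rule: linorder_cases)
  case less
  have "\<exists>z>x. z < y \<and> qlog a y - qlog a x = (y - x) * z powr (a - 1)"
    using less assms by (intro MVT2 DERIV_qlog) auto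
  then obtain z where z: "z > x" "qlog a y - qlog a x = (y - x) * z powr (a - 1)" by auto
  have "z powr (a - 1) \<le> x powr (a - 1)"
    using z assms by (intro powr_mono2') auto
  then have "(y - x) * z powr (a - 1) \<le> (y - x) * x powr (a - 1)"
    using less by (intro mult_left_mono) auto
  then show ?thesis using z by (simp add: mult.commute)
next
  case greater
  have "\<exists>z>y. z < x \<and> qlog a x - qlog a y = (x - y) * z powr (a - 1)"
    using greater assms by (intro MVT2 DERIV_qlog) auto
  then obtain z where z: "z > y" "z < x" "qlog a x - qlog a y = (x - y) * z powr (a - 1)" by auto
  have "x powr (a - 1) \<le> z powr (a - 1)"
    using z assms by (intro powr_mono2') auto
  then have "(x - y) * x powr (a - 1) \<le> (x - y) * z powr (a - 1)"
    using greater by (intro mult_left_mono) auto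
  then show ?thesis using z by (simp add: algebra_simps)
qed auto

lemma qlog_strict_mono:
  assumes "0 < x" "x < y"
  shows "qlog a x < qlog a y"
proof -
  have "\<exists>z>x. z < y \<and> qlog a y - qlog a x = (y - x) * z powr (a - 1)"
    using assms by (intro MVT2 DERIV_qlog) auto
  then obtain z where "z > x" "qlog a y - qlog a x = (y - x) * z powr (a - 1)" by auto
  moreover have "(y - x) * z powr (a - 1) > 0" using assms \<open>z > x\<close> by simp
  ultimately show ?thesis by linarith
qed

lemma qlog_mono:
  assumes "0 < x" "x \<le> y"
  shows "qlog a x \<le> qlog a y"
  using assms qlog_strict_mono[of x y a] by (cases "x = y") auto

lemma qlog_pos:
  assumes "x > 1"
  shows "qlog a x > 0"
  using qlog_strict_mono[of 1 x a] assms by simp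

lemma qlog_lower:
  assumes "a \<le> 1" "x > 0"
  shows "x powr (a - 1) * (x - 1) \<le> qlog a x"
  using qlog_tangent[OF assms, of 1] by (simp add: algebra_simps)

text \<open>From 1 + u \<le> exp u at u = a * ln x; dividing by a negative a reverses the
  inequality.\<close>

lemma qlog_le_ln:
  assumes "a \<le> 0" "x \<ge> 1"
  shows "qlog a x \<le> ln x"
proof (cases "a = 0")
  case False
  have "1 + a * ln x \<le> x powr a"
    using assms exp_ge_add_one_self[of "a * ln x"] by (simp add: powr_def)
  then show ?thesis using False assms by (simp add: qlog_def field_simps)
qed (simp add: qlog_def)

text \<open>Again 1 + u \<le> exp u, now at u = - a * ln x, multiplied by
  \<open>x powr a\<close>.\<close>

lemma qlog_le_powr_ln:
  assumes "a \<ge> 0" "x \<ge> 1"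
  shows "qlog a x \<le> x powr a * ln x"
proof (cases "a = 0")
  case False
  have "1 - a * ln x \<le> x powr (-a)"
    using assms exp_ge_add_one_self[of "- (a * ln x)"] by (simp add: powr_def)
  then have "(1 - a * ln x) * x powr a \<le> x powr (-a) * x powr a"
    by (intro mult_right_mono) auto
  also have "\<dots> = 1" using assms by (simp flip: powr_add)
  finally show ?thesis using False assms by (simp add: qlog_def field_simps)
qed (use assms in \<open>simp add: qlog_def\<close>)

section \<open>The Tsallis potential and its Bregman divergence\<close>

definition tsallis_potential :: "real \<Rightarrow> real \<Rightarrow> real" where
  "tsallis_potential \<alpha> z = z * qlog (\<alpha> - 1) z - qlog \<alpha> z"

text \<open>The product rule yields \<open>qlog (\<alpha> - 1) z\<close> and two powers of z that
  cancel. With this choice of antiderivative both value and slope vanish at 1.\<close>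

lemma DERIV_tsallis_potential:
  assumes "z > 0"
  shows "(tsallis_potential \<alpha> has_real_derivative qlog (\<alpha> - 1) z) (at z)"
proof -
  have "z * z powr (\<alpha> - 1 - 1) = z powr (\<alpha> - 1)"
    using assms by (simp add: powr_diff power2_eq_square)
  then show ?thesis
    unfolding tsallis_potential_def [abs_def] using assms
    by (auto intro!: derivative_eq_intros DERIV_qlog simp: mult.commute)
qed

lemma tsallis_potential_Taylor:
  assumes "v > 0" "w > 0" "v \<noteq> w"
  obtains s where "min v w < s" "s < max v w"
    "tsallis_potential \<alpha> v =
       tsallis_potential \<alpha> w + qlog (\<alpha> - 1) w * (v - w) + s powr (\<alpha> - 2) / 2 * (v - w)\<^sup>2"
proof -
  define d where "d m = (if m = 0 then tsallis_potential \<alpha>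
    else if m = (1 :: nat) then qlog (\<alpha> - 1) else (\<lambda>z. z powr (\<alpha> - 2)))" for m
  have d: "(d m has_real_derivative d (Suc m) t) (at t)" if "m < 2" "t > 0" for m t
    using that DERIV_qlog[of t "\<alpha> - 1"] by (auto simp: d_def DERIV_tsallis_potential less_2_cases_iff)
  have d0: "d 0 = tsallis_potential \<alpha>" by (simp add: d_def)
  have "\<exists>t. (if v < w then v < t \<and> t < w else w < t \<and> t < v) \<and>
     tsallis_potential \<alpha> v = (\<Sum>m<2. d m w / fact m * (v - w) ^ m) + d 2 t / fact 2 * (v - w) ^ 2"
    by (intro Taylor[where a = "min v w" and b = "max v w"] d0 allI impI d) (use assms in auto)
  then obtain t where "if v < w then v < t \<and> t < w else w < t \<and> t < v"
     "tsallis_potential \<alpha> v = (\<Sum>m<2. d m w / fact m * (v - w) ^ m) + d 2 t / fact 2 * (v - w) ^ 2"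
    by blast
  then show ?thesis
    by (intro that[of t]) (auto simp: d_def numeral_2_eq_2 split: if_splits)
qed

definition potential_bregman :: "real \<Rightarrow> real \<Rightarrow> real \<Rightarrow> real" where
  "potential_bregman \<alpha> v w =
     tsallis_potential \<alpha> v - tsallis_potential \<alpha> w - qlog (\<alpha> - 1) w * (v - w)"

text \<open>Taylor's formula requires v > 0, so the boundary value is computed in closed form. For
  \<alpha> = 0 the true potential is infinite at 0 while \<open>ln 0 = 0\<close> gives a finite
  default, which is why the lemmas below demand v > 0 in that case.\<close>

lemma potential_bregman_0:
  assumes "\<alpha> > 0" "w > 0"
  shows "potential_bregman \<alpha> 0 w = w powr \<alpha> / \<alpha>"
  using assms
  by (simp add: potential_bregman_def tsallis_potential_def) (simp add: qlog_def field_simps)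

lemma potential_bregman_pos:
  assumes "0 \<le> \<alpha>" "w > 0" "v \<ge> 0" "\<alpha> = 0 \<Longrightarrow> v > 0" "v \<noteq> w"
  shows "potential_bregman \<alpha> v w > 0"
proof (cases "v = 0")
  case True
  then show ?thesis using assms potential_bregman_0[of \<alpha> w] by (cases "\<alpha> = 0") auto
next
  case False
  with assms have "v > 0" by simp
  then obtain s where "min v w < s" "s < max v w"
    "tsallis_potential \<alpha> v =
       tsallis_potential \<alpha> w + qlog (\<alpha> - 1) w * (v - w) + s powr (\<alpha> - 2) / 2 * (v - w)\<^sup>2"
    using tsallis_potential_Taylor assms by metis
  moreover have "s > 0" using calculation \<open>v > 0\<close> assms by linarith
  then have "s powr (\<alpha> - 2) / 2 * (v - w)\<^sup>2 > 0" using assms by simp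
  ultimately show ?thesis unfolding potential_bregman_def by linarith
qed

lemma potential_bregman_nonneg:
  assumes "0 \<le> \<alpha>" "w > 0" "v \<ge> 0" "\<alpha> = 0 \<Longrightarrow> v > 0"
  shows "potential_bregman \<alpha> v w \<ge> 0"
  using potential_bregman_pos[OF assms] by (cases "v = w") (auto simp: potential_bregman_def)

text \<open>For v \<le> w the Taylor point s satisfies s \<le> w, and
  \<open>s powr (\<alpha> - 2)\<close> decreases in s, so the curvature at w is a lower bound. At v
  = 0 the closed form takes over, with 1 / 2 \<le> 1 / \<alpha>.\<close>

lemma potential_bregman_quadratic:
  assumes "0 \<le> \<alpha>" "\<alpha> \<le> 1" "w > 0" "v \<ge> 0" "\<alpha> = 0 \<Longrightarrow> v > 0" "v \<le> w"
  shows "potential_bregman \<alpha> v w \<ge> w powr (\<alpha> - 2) / 2 * (v - w)\<^sup>2"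
proof -
  consider "v = 0" | "v > 0" "v = w" | "v > 0" "v \<noteq> w" using assms by fastforce
  then show ?thesis
  proof cases
    case 1
    then have "\<alpha> > 0" using assms by fastforce
    have "w powr (\<alpha> - 2) * w\<^sup>2 = w powr \<alpha>"
      using assms by (simp add: powr_diff powr_numeral)
    moreover have "w powr \<alpha> / 2 \<le> w powr \<alpha> / \<alpha>"
      using assms \<open>\<alpha> > 0\<close> by (intro divide_left_mono) auto
    ultimately show ?thesis using 1 \<open>\<alpha> > 0\<close> assms by (simp add: potential_bregman_0)
  next
    case 2
    then show ?thesis by (simp add: potential_bregman_def)
  next
    case 3
    then obtain s where s: "min v w < s" "s < max v w"
      "tsallis_potential \<alpha> v =
         tsallis_potential \<alpha> w + qlog (\<alpha> - 1) w * (v - w) + s powr (\<alpha> - 2) / 2 * (v - w)\<^sup>2"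
      using tsallis_potential_Taylor assms by metis
    have "s > 0" "s \<le> w" using s 3 assms by linarith+
    then have "w powr (\<alpha> - 2) \<le> s powr (\<alpha> - 2)"
      using assms by (intro powr_mono2') auto
    then have "w powr (\<alpha> - 2) / 2 * (v - w)\<^sup>2 \<le> s powr (\<alpha> - 2) / 2 * (v - w)\<^sup>2"
      by (intro mult_right_mono) auto
    then show ?thesis using s unfolding potential_bregman_def by linarith
  qed
qed

text \<open>For v > w the linear gain is nonpositive. For v \<le> w, with the relative decrease y =
  (w - v) / w and x \<le> 1, the quadratic bound leaves y - y^2 * w^\<alpha> / (2 * \<eta>);
  completing the square gives its maximum over y, which is the right-hand side.\<close>

lemma potential_stability:
  assumes "0 \<le> \<alpha>" "\<alpha> \<le> 1" "w > 0" "v \<ge> 0" "\<alpha> = 0 \<Longrightarrow> v > 0" "\<eta> > 0" "0 \<le> x" "x \<le> 1"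
  shows "(w - v) * (x / w) - potential_bregman \<alpha> v w / \<eta> \<le> \<eta> / 2 * w powr (- \<alpha>)"
proof (cases "v \<le> w")
  case True
  define y where "y = (w - v) / w"
  have y: "y\<^sup>2 * w powr \<alpha> / 2 \<le> potential_bregman \<alpha> v w"
    using potential_bregman_quadratic[OF assms(1-5) True] assms
    by (simp add: y_def powr_diff power2_commute powr_numeral power_divide field_simps)
  define p where "p = w powr (\<alpha> / 2)"
  have p: "w powr \<alpha> = p\<^sup>2" "p > 0"
    using assms by (simp_all add: p_def power2_eq_square flip: powr_add)
  have "0 \<le> y" using True assms by (simp add: y_def)
  have "(w - v) * (x / w) = y * x" by (simp add: y_def)
  also have "\<dots> \<le> y" using \<open>0 \<le> y\<close> assms by (simp add: mult_left_le)
  also have "y \<le> y\<^sup>2 * p\<^sup>2 / (2 * \<eta>) + \<eta> / (2 * p\<^sup>2)"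
  proof -
    have "0 \<le> (y * p\<^sup>2 - \<eta>)\<^sup>2 / (2 * \<eta> * p\<^sup>2)" using p assms by simp
    also have "\<dots> = y\<^sup>2 * p\<^sup>2 / (2 * \<eta>) + \<eta> / (2 * p\<^sup>2) - y"
      using p assms by (simp add: field_simps power2_eq_square)
    finally show ?thesis by simp
  qed
  also have "y\<^sup>2 * p\<^sup>2 / (2 * \<eta>) \<le> potential_bregman \<alpha> v w / \<eta>"
    using y p assms by (simp add: field_simps)
  also have "\<eta> / (2 * p\<^sup>2) = \<eta> / 2 * w powr (- \<alpha>)"
    using p by (simp add: powr_minus field_simps)
  finally show ?thesis by linarith
next
  case False
  then have "(w - v) * (x / w) \<le> 0"
    using assms by (intro mult_nonpos_nonneg) auto
  moreover have "0 \<le> potential_bregman \<alpha> v w / \<eta>" "0 \<le> \<eta> / 2 * w powr (- \<alpha>)"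
    using assms potential_bregman_nonneg[OF assms(1,3,4,5)] by auto
  ultimately show ?thesis by linarith
qed

section \<open>Optimality and stability of the weights\<close>

definition potential :: "real \<Rightarrow> real ^ 'k \<Rightarrow> real" where
  "potential \<alpha> w = (\<Sum>i\<in>UNIV. tsallis_potential \<alpha> (w $ i))"

text \<open>The shift C is 0 at the endpoints and K / \<alpha> inside, where the regularizer omits 1
  / \<alpha> per coordinate. An additive constant does not move optimizers, so only its existence is
  recorded.\<close>

lemma tsallis_reg_eq_potential:
  obtains C where "\<And>w :: real ^ ('k::finite). w \<in> prob_simplex \<Longrightarrow> (\<alpha> = 0 \<Longrightarrow> \<forall>i. w $ i > 0) \<Longrightarrow>
    tsallis_reg \<alpha> w = ereal (potential \<alpha> w - C)"
proof (cases "\<alpha> = 0 \<or> \<alpha> = 1")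
  case True
  then have "tsallis_reg \<alpha> w = ereal (potential \<alpha> w - 0)"
    if "w \<in> prob_simplex" "\<alpha> = 0 \<Longrightarrow> \<forall>i. w $ i > 0" for w :: "real ^ 'k"
  proof (rule disjE)
    assume "\<alpha> = 0"
    with that have pos: "\<forall>i. w $ i > 0" by simp
    then have "w $ i * ((w $ i) powr - 1 - 1) = 1 - w $ i" for i
      by (simp add: powr_minus_divide algebra_simps less_imp_neq[symmetric] abs_of_pos)
    moreover have "\<nexists>i. w $ i = 0" using pos by (metis less_irrefl)
    ultimately show ?thesis using \<open>\<alpha> = 0\<close>
      by (simp add: tsallis_reg_def potential_def tsallis_potential_def qlog_def sum_negf[symmetric]
          algebra_simps del: sum_negf)
  next
    assume "\<alpha> = 1"
    then show ?thesis using that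
      by (simp add: tsallis_reg_def potential_def tsallis_potential_def qlog_def prob_simplex_def
          algebra_simps)
  qed
  then show ?thesis using that by blast
next
  case False
  define C where "C = real CARD('k) / \<alpha>"
  have "tsallis_reg \<alpha> w = ereal (potential \<alpha> w - C)"
    if "w \<in> prob_simplex" for w :: "real ^ 'k"
  proof -
    have "tsallis_potential \<alpha> (w $ i) = 1 / \<alpha> - ((w $ i) powr \<alpha> - \<alpha> * (w $ i)) / (\<alpha> * (1 - \<alpha>))" for i
    proof -
      have "w $ i \<ge> 0" using that by (simp add: prob_simplex_def)
      then have "w $ i * (w $ i) powr (\<alpha> - 1) = (w $ i) powr \<alpha>"
        by (cases "w $ i = 0") (auto simp: powr_diff)
      then have "w $ i * qlog (\<alpha> - 1) (w $ i) = ((w $ i) powr \<alpha> - w $ i) / (\<alpha> - 1)"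
        using False by (simp add: qlog_def algebra_simps)
      then show ?thesis using False
        by (simp add: tsallis_potential_def) (simp add: qlog_def divide_simps, simp add: algebra_simps)
    qed
    then show ?thesis using False
      by (simp add: tsallis_reg_def potential_def C_def sum_subtractf)
  qed
  then show ?thesis using that by blast
qed

text \<open>The first-order condition on the simplex: c is the Lagrange multiplier of the constraint
  that the coordinates sum to 1. An interior point has no multipliers for nonnegativity.\<close>

definition ftrl_optimal :: "real \<Rightarrow> real \<Rightarrow> real ^ 'k \<Rightarrow> real ^ 'k \<Rightarrow> bool" where
  "ftrl_optimal \<alpha> \<eta> L w \<longleftrightarrow>
     w \<in> prob_simplex \<and> (\<forall>i. w $ i > 0) \<and> (\<exists>c. \<forall>i. L $ i + qlog (\<alpha> - 1) (w $ i) / \<eta> = c)"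

text \<open>The gradient of the objective at w is the constant vector c and v - w sums to 0, so the
  linear term disappears and the gap is exactly a Bregman divergence.\<close>

lemma objective_gap:
  fixes w v L :: "real ^ ('k::finite)"
  assumes "ftrl_optimal \<alpha> \<eta> L w" "v \<in> prob_simplex"
  shows "v \<bullet> L + potential \<alpha> v / \<eta> =
    w \<bullet> L + potential \<alpha> w / \<eta> + (\<Sum>i\<in>UNIV. potential_bregman \<alpha> (v $ i) (w $ i)) / \<eta>"
proof -
  from assms(1) obtain c where c: "\<And>i. L $ i + qlog (\<alpha> - 1) (w $ i) / \<eta> = c"
    by (auto simp: ftrl_optimal_def)
  have eq: "v $ i * L $ i + tsallis_potential \<alpha> (v $ i) / \<eta> -
     (w $ i * L $ i + tsallis_potential \<alpha> (w $ i) / \<eta> + potential_bregman \<alpha> (v $ i) (w $ i) / \<eta>) =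
     (v $ i - w $ i) * (L $ i + qlog (\<alpha> - 1) (w $ i) / \<eta>)" for i
    by (simp add: potential_bregman_def add_divide_distrib diff_divide_distrib algebra_simps)
  have "(\<Sum>i\<in>UNIV. v $ i * L $ i + tsallis_potential \<alpha> (v $ i) / \<eta> -
     (w $ i * L $ i + tsallis_potential \<alpha> (w $ i) / \<eta> + potential_bregman \<alpha> (v $ i) (w $ i) / \<eta>)) =
     (\<Sum>i\<in>UNIV. v $ i - w $ i) * c"
    by (simp only: eq c sum_distrib_right)
  also have "\<dots> = 0"
    using assms by (simp add: sum_subtractf ftrl_optimal_def prob_simplex_def)
  finally show ?thesis
    by (simp add: inner_vec_def potential_def sum.distrib sum_subtractf sum_divide_distrib)
qed

lemma ftrl_optimal_less:
  fixes w v L :: "real ^ ('k::finite)"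
  assumes "ftrl_optimal \<alpha> \<eta> L w" "v \<in> prob_simplex" "v \<noteq> w" "0 \<le> \<alpha>" "\<eta> > 0"
    and "\<alpha> = 0 \<Longrightarrow> \<forall>i. v $ i > 0"
  shows "w \<bullet> L + potential \<alpha> w / \<eta> < v \<bullet> L + potential \<alpha> v / \<eta>"
proof -
  obtain j where "v $ j \<noteq> w $ j" using assms(3) by (auto simp: vec_eq_iff)
  have "(\<Sum>i\<in>UNIV. potential_bregman \<alpha> (v $ i) (w $ i)) > 0"
  proof (rule sum_pos2[of _ j])
    show "0 < potential_bregman \<alpha> (v $ j) (w $ j)"
      using assms \<open>v $ j \<noteq> w $ j\<close>
      by (intro potential_bregman_pos) (auto simp: ftrl_optimal_def prob_simplex_def)
    show "0 \<le> potential_bregman \<alpha> (v $ i) (w $ i)" for i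
      using assms by (intro potential_bregman_nonneg) (auto simp: ftrl_optimal_def prob_simplex_def)
  qed auto
  then show ?thesis using objective_gap[OF assms(1,2)] assms by simp
qed

text \<open>\<open>arg_max_on\<close> is a choice operator, so it is pinned down by showing that w
  is the only maximiser. For \<alpha> = 0 boundary points have value minus infinity; all other
  points lose by \<open>ftrl_optimal_less\<close>.\<close>

lemma tsallis_weights_eq:
  fixes w L :: "real ^ ('k::finite)"
  assumes opt: "ftrl_optimal \<alpha> \<eta> L w" and "0 \<le> \<alpha>" "\<eta> > 0"
  shows "tsallis_weights \<alpha> \<eta> L = w"
proof -
  define f where "f = (\<lambda>w. ereal (w \<bullet> (- L)) - tsallis_reg \<alpha> w / ereal \<eta>)"
  obtain C where C: "\<And>w :: real ^ 'k. w \<in> prob_simplex \<Longrightarrow> (\<alpha> = 0 \<Longrightarrow> \<forall>i. w $ i > 0) \<Longrightarrow>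
    tsallis_reg \<alpha> w = ereal (potential \<alpha> w - C)"
    using tsallis_reg_eq_potential by blast
  have w: "w \<in> prob_simplex" "\<And>i. w $ i > 0" using opt by (auto simp: ftrl_optimal_def)
  have f: "f v = ereal (C / \<eta> - (v \<bullet> L + potential \<alpha> v / \<eta>))"
    if "v \<in> prob_simplex" "\<alpha> = 0 \<Longrightarrow> \<forall>i. v $ i > 0" for v
    using C[OF that] assms by (simp add: f_def diff_divide_distrib)
  have less: "f v < f w" if v: "v \<in> prob_simplex" "v \<noteq> w" for v
  proof (cases "\<alpha> = 0 \<and> \<not> (\<forall>i. v $ i > 0)")
    case True
    then have "\<exists>i. v $ i = 0"
      using v by (auto simp: prob_simplex_def) (metis antisym_conv2)
    with True have "f v = - \<infinity>"
      using assms by (simp add: f_def tsallis_reg_def)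
    then show ?thesis using f[of w] w by simp
  next
    case False
    then show ?thesis
      using ftrl_optimal_less[OF opt v assms(2,3)] f[of w] f[of v] w v by auto
  qed
  have "is_arg_max f (\<lambda>x. x \<in> prob_simplex) v \<longleftrightarrow> v = w" for v
    unfolding is_arg_max_def using less w by (metis less_asym)
  then have "arg_max_on f prob_simplex = w"
    by (simp add: arg_max_on_def arg_max_def)
  then show ?thesis using assms by (simp add: tsallis_weights_def f_def)
qed

section \<open>Uniform weights and existence of optimal weights\<close>

definition uniform_weights :: "real ^ ('k::finite)" where
  "uniform_weights = (\<chi> i. 1 / real CARD('k))"

lemma uniform_weights_nth [simp]: "(uniform_weights :: real ^ ('k::finite)) $ i = 1 / real CARD('k)"
  by (simp add: uniform_weights_def)

lemma ftrl_optimal_uniform: "ftrl_optimal \<alpha> \<eta> 0 uniform_weights"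
  by (simp add: ftrl_optimal_def prob_simplex_def)

text \<open>Minimising the regularizer alone is the objective with zero losses and rate 1, and by
  symmetry the uniform point satisfies its first-order condition.\<close>

lemma tsallis_weights_zero_rate:
  fixes L :: "real ^ ('k::finite)"
  assumes "0 \<le> \<alpha>"
  shows "tsallis_weights \<alpha> 0 L = uniform_weights"
proof -
  let ?w = "uniform_weights :: real ^ 'k"
  obtain C where C: "\<And>w :: real ^ 'k. w \<in> prob_simplex \<Longrightarrow> (\<alpha> = 0 \<Longrightarrow> \<forall>i. w $ i > 0) \<Longrightarrow>
    tsallis_reg \<alpha> w = ereal (potential \<alpha> w - C)"
    using tsallis_reg_eq_potential by blast
  have w: "?w \<in> prob_simplex" "\<And>i. ?w $ i > 0"
    by (simp_all add: prob_simplex_def)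
  have less: "tsallis_reg \<alpha> ?w < tsallis_reg \<alpha> v" if v: "v \<in> prob_simplex" "v \<noteq> ?w" for v
  proof (cases "\<alpha> = 0 \<and> \<not> (\<forall>i. v $ i > 0)")
    case True
    then have "\<exists>i. v $ i = 0"
      using v by (auto simp: prob_simplex_def) (metis antisym_conv2)
    with True have "tsallis_reg \<alpha> v = \<infinity>"
      using assms by (simp add: tsallis_reg_def)
    then show ?thesis using C[of ?w] w by simp
  next
    case False
    then show ?thesis
      using ftrl_optimal_less[OF ftrl_optimal_uniform v assms, of 1] C[of ?w] C[of v] w v by auto
  qed
  have "is_arg_min (tsallis_reg \<alpha>) (\<lambda>x. x \<in> prob_simplex) v \<longleftrightarrow> v = ?w" for v
    unfolding is_arg_min_def using less w by (metis less_asym)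
  then have "arg_min_on (tsallis_reg \<alpha>) prob_simplex = ?w"
    by (simp add: arg_min_on_def arg_min_def)
  then show ?thesis by (simp add: tsallis_weights_def)
qed

text \<open>E inverts the slope of the potential on nonpositive values, which suffices because
  weights are at most 1. It is \<open>exp\<close> for a = 0 and
  \<open>(1 + a * y) powr (1 / a)\<close> otherwise; y \<le> 0 keeps the base positive.\<close>

lemma qlog_inverse:
  assumes "a \<le> 0"
  obtains E where "\<And>y. y \<le> 0 \<Longrightarrow> E y > 0" "\<And>y. y \<le> 0 \<Longrightarrow> qlog a (E y) = y"
    "continuous_on {..0} E" "E 0 = 1"
proof (cases "a = 0")
  case True
  show ?thesis
    by (rule that[of exp]) (auto simp: True qlog_def intro!: continuous_intros)
next
  case False
  then have a: "a < 0" using assms by simp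
  have pos: "1 + a * y > 0" if "y \<le> 0" for y
    using a that by (simp add: add_pos_nonneg mult_nonpos_nonpos)
  show ?thesis
    by (rule that[of "\<lambda>y. (1 + a * y) powr (1 / a)"])
      (use a pos in \<open>auto simp: qlog_def powr_powr less_imp_neq[OF pos, symmetric] abs_of_pos[OF pos] intro!: continuous_intros\<close>)
qed

text \<open>Solving the first-order condition expresses all weights through the multiplier
  \<open>lam\<close>, namely \<open>E (\<eta> * (lam - L $ i))\<close>; the intermediate value
  theorem then chooses \<open>lam\<close> so that they sum to 1.\<close>

lemma ftrl_optimal_exists:
  fixes L :: "real ^ ('k::finite)"
  assumes "\<alpha> \<le> 1" "\<eta> > 0"
  obtains w where "ftrl_optimal \<alpha> \<eta> L w"
proof -
  obtain E where E: "\<And>y. y \<le> 0 \<Longrightarrow> E y > 0" "\<And>y. y \<le> 0 \<Longrightarrow> qlog (\<alpha> - 1) (E y) = y"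
    "continuous_on {..0} E" "E 0 = 1"
    using qlog_inverse[of "\<alpha> - 1"] assms by auto
  define q where "q = qlog (\<alpha> - 1) (1 / real CARD('k))"
  have "q \<le> 0" using qlog_mono[of "1 / real CARD('k)" 1 "\<alpha> - 1"] by (simp add: q_def)
  have small: "E y \<le> 1 / real CARD('k)" if "y \<le> q" for y
  proof (rule ccontr)
    assume "\<not> ?thesis"
    then have "q < qlog (\<alpha> - 1) (E y)" unfolding q_def by (intro qlog_strict_mono) auto
    then show False using E(2)[of y] that \<open>q \<le> 0\<close> by simp
  qed
  define m where "m = Min (range (($) L))"
  have m: "m \<le> L $ i" for i by (simp add: m_def)
  have "m \<in> range (($) L)" unfolding m_def by (intro Min_in) auto
  then obtain j where j: "L $ j = m" by auto
  define S where "S lam = (\<Sum>i\<in>UNIV. E (\<eta> * (lam - L $ i)))" for lam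
  have arg: "\<eta> * (lam - L $ i) \<le> 0" if "lam \<le> m" for lam i
    using assms that m[of i] by (intro mult_nonneg_nonpos) auto
  \<comment> \<open>At the left end each term is at most 1 / K. At the right end an arm of least
    cumulative loss alone contributes \<open>E 0 = 1\<close>.\<close>
  have "\<exists>lam\<ge>m + q / \<eta>. lam \<le> m \<and> S lam = 1"
  proof (rule IVT')
    have "E (\<eta> * (m + q / \<eta> - L $ i)) \<le> 1 / real CARD('k)" for i
      using m[of i] assms by (intro small) (simp add: algebra_simps)
    then have "S (m + q / \<eta>) \<le> (\<Sum>i\<in>(UNIV::'k set). 1 / real CARD('k))"
      unfolding S_def by (intro sum_mono) auto
    then show "S (m + q / \<eta>) \<le> 1" by simp
    have "E (\<eta> * (m - L $ j)) \<le> S m"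
      unfolding S_def using E(1) arg by (intro member_le_sum) (auto simp: less_imp_le)
    then show "1 \<le> S m" using j E by simp
    show "m + q / \<eta> \<le> m" using \<open>q \<le> 0\<close> assms by (simp add: divide_nonpos_pos)
    show "continuous_on {m + q / \<eta>..m} S"
      unfolding S_def [abs_def] using arg
      by (intro continuous_on_sum continuous_on_compose2[OF E(3)] continuous_intros) auto
  qed
  then obtain lam where lam: "lam \<le> m" "S lam = 1" by blast
  define w where "w = (\<chi> i. E (\<eta> * (lam - L $ i)))"
  have "ftrl_optimal \<alpha> \<eta> L w"
    unfolding ftrl_optimal_def prob_simplex_def
  proof (safe intro!: exI[of _ lam])
    show "0 < w $ i" for i using E(1) arg lam by (simp add: w_def)
    then show "0 \<le> w $ i" for i by (simp add: less_imp_le)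
    show "L $ i + qlog (\<alpha> - 1) (w $ i) / \<eta> = lam" for i
      using E(2)[OF arg[OF lam(1)]] assms by (simp add: w_def)
  qed (use lam in \<open>simp add: w_def S_def\<close>)
  then show ?thesis by (rule that)
qed

lemma ftrl_optimal_tsallis_weights:
  assumes "0 \<le> \<alpha>" "\<alpha> \<le> 1" "\<eta> > 0"
  shows "ftrl_optimal \<alpha> \<eta> L (tsallis_weights \<alpha> \<eta> L)"
  using ftrl_optimal_exists[of \<alpha> \<eta> L] tsallis_weights_eq[of \<alpha> \<eta> L] assms by metis

text \<open>The estimate has only coordinate i, so the nonnegative Bregman terms of the other
  coordinates are dropped and \<open>potential_stability\<close> is applied at i. The point v stays
  arbitrary: it is later both the next weight vector and the final comparator.\<close>

lemma ftrl_stability: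
  fixes w v L :: "real ^ ('k::finite)"
  assumes opt: "ftrl_optimal \<alpha> \<eta> L w" and v: "v \<in> prob_simplex" "\<alpha> = 0 \<Longrightarrow> \<forall>i. v $ i > 0"
    and "0 \<le> \<alpha>" "\<alpha> \<le> 1" "\<eta> > 0" "0 \<le> x" "x \<le> 1"
  shows "w \<bullet> L + potential \<alpha> w / \<eta> + x \<le>
    v \<bullet> (L + iw_estimate w i x) + potential \<alpha> v / \<eta> + \<eta> / 2 * (w $ i) powr (- \<alpha>)"
proof -
  have w: "w $ j > 0" for j using opt by (simp add: ftrl_optimal_def)
  have nonneg: "0 \<le> potential_bregman \<alpha> (v $ j) (w $ j)" for j
    using assms w by (intro potential_bregman_nonneg) (auto simp: prob_simplex_def)
  have est: "v \<bullet> iw_estimate w i x = v $ i * x / w $ i"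
    by (simp add: inner_vec_def iw_estimate_def if_distrib if_distribR cong: if_cong)
  have "(w $ i - v $ i) * (x / w $ i) - potential_bregman \<alpha> (v $ i) (w $ i) / \<eta>
      \<le> \<eta> / 2 * (w $ i) powr (- \<alpha>)"
    using assms w by (intro potential_stability) (auto simp: prob_simplex_def)
  moreover have "(w $ i - v $ i) * (x / w $ i) = x - v $ i * x / w $ i"
    using w[of i] by (simp add: field_simps)
  moreover have "potential_bregman \<alpha> (v $ i) (w $ i) / \<eta> \<le>
      (\<Sum>j\<in>UNIV. potential_bregman \<alpha> (v $ j) (w $ j)) / \<eta>"
    using nonneg assms by (intro divide_right_mono member_le_sum) auto
  ultimately show ?thesis
    unfolding inner_add_right est using objective_gap[OF opt v(1)] by linarith
qed

section \<open>Learning rates and the bound on a single run\<close>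

text \<open>A factor depending on K separates from a factor depending on t, endpoints included, so
  ratios of rates depend on time only.\<close>

lemma learning_rate_eq:
  assumes "K \<ge> 1" "t \<ge> 1"
  shows "learning_rate \<alpha> K t =
    sqrt (K powr (- \<alpha>) * qlog (1 - \<alpha>) K * (qlog (- \<alpha>) (real t) / real t))"
proof -
  consider "\<alpha> = 0" | "\<alpha> = 1" | "\<alpha> \<noteq> 0" "\<alpha> \<noteq> 1" by blast
  then show ?thesis
  proof cases
    case 1
    then show ?thesis using assms by (simp add: learning_rate_0) (simp add: qlog_def)
  next
    case 2
    then show ?thesis using assms by (simp add: learning_rate_1) (simp add: qlog_def powr_minus_divide)
  next
    case 3
    have "K powr (1 - 2 * \<alpha>) - K powr (- \<alpha>) = K powr (- \<alpha>) * (K powr (1 - \<alpha>) - 1)"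
      by (simp add: right_diff_distrib flip: powr_add)
    then show ?thesis using 3
      by (simp add: learning_rate_def learning_rate_interior_def qlog_def minus_divide_left
         flip: minus_divide_right)
  qed
qed

text \<open>Since 3 > e, ln t \<ge> 1 and hence t^\<alpha> \<ge> exp \<alpha> \<ge> 1 + \<alpha>.
  The inequality says that \<open>qlog (- \<alpha>) t / t\<close> has nonpositive derivative at
  t.\<close>

lemma powr_le_qlog_neg:
  assumes "0 \<le> \<alpha>" "t \<ge> 3"
  shows "t powr (- \<alpha>) \<le> qlog (- \<alpha>) t"
proof -
  have "1 \<le> ln t" using assms exp_le by (subst ln_ge_iff) auto
  show ?thesis
  proof (cases "\<alpha> = 0")
    case True
    then show ?thesis using assms \<open>1 \<le> ln t\<close> by (simp add: qlog_def)
  next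
    case False
    have "1 + \<alpha> \<le> exp (\<alpha> * 1)" using exp_ge_add_one_self[of \<alpha>] by simp
    also have "\<dots> \<le> t powr \<alpha>"
      using assms \<open>1 \<le> ln t\<close> by (simp add: powr_def mult_le_cancel_left1)
    finally have "(1 + \<alpha>) * t powr (- \<alpha>) \<le> 1"
      using assms by (simp add: powr_minus field_simps)
    then show ?thesis using False assms by (simp add: qlog_def field_simps)
  qed
qed

lemma qlog_neg_div_antimono:
  assumes "0 \<le> \<alpha>" "t \<ge> 3"
  shows "qlog (- \<alpha>) (t + 1) / (t + 1) \<le> qlog (- \<alpha>) t / t"
proof -
  have "qlog (- \<alpha>) (t + 1) \<le> qlog (- \<alpha>) t + t powr (- \<alpha> - 1)"
    using qlog_tangent[of "- \<alpha>" t "t + 1"] assms by simp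
  also have "t powr (- \<alpha> - 1) = t powr (- \<alpha>) / t"
    using assms by (simp add: powr_diff)
  also have "\<dots> \<le> qlog (- \<alpha>) t / t"
    using powr_le_qlog_neg[OF assms] assms by (simp add: divide_right_mono)
  finally show ?thesis using assms by (simp add: field_simps)
qed

text \<open>Concavity twice: the increment from 2 to 3 is at most the slope at 2, which is at most
  the increment from 1 to 2.\<close>

lemma qlog_neg_3_le:
  assumes "0 \<le> \<alpha>"
  shows "qlog (- \<alpha>) 3 \<le> 2 * qlog (- \<alpha>) 2"
proof -
  have "2 powr (- \<alpha> - 1) \<le> qlog (- \<alpha>) 2"
    using qlog_lower[of "- \<alpha>" 2] assms by simp
  then show ?thesis using qlog_tangent[of "- \<alpha>" 2 3] assms by simp
qed

text \<open>
  Round 1 plays the uniform distribution, which is optimal for every learning rate when no loss has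
  been observed yet; so the vanishing rate of round 1 may be replaced by the rate of round 2.
\<close>

definition positive_rate :: "real \<Rightarrow> real \<Rightarrow> nat \<Rightarrow> real" where
  "positive_rate \<alpha> K t = learning_rate \<alpha> K (max t 2)"

definition rate_increase :: "real \<Rightarrow> real \<Rightarrow> nat \<Rightarrow> real" where
  "rate_increase \<alpha> K t = max 0 (positive_rate \<alpha> K (Suc t) / positive_rate \<alpha> K t - 1)"

text \<open>For K \<ge> 2 this makes the factor \<open>D\<close> of \<open>regret_sum_le\<close> at
  least 1.\<close>

lemma powr_mult_qlog_ge:
  assumes "\<alpha> \<ge> 0" "K > 0"
  shows "K - 1 \<le> K powr \<alpha> * qlog (1 - \<alpha>) K"
proof -
  have "K powr \<alpha> * (K powr (- \<alpha>) * (K - 1)) \<le> K powr \<alpha> * qlog (1 - \<alpha>) K"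
    using qlog_lower[of "1 - \<alpha>" K] assms by (intro mult_left_mono) auto
  then show ?thesis using assms by (simp add: powr_minus flip: mult.assoc)
qed

lemma positive_rate_pos:
  assumes "K > 1"
  shows "positive_rate \<alpha> K t > 0"
  using assms by (simp add: positive_rate_def learning_rate_eq qlog_pos)

lemma rate_increase_nonneg: "rate_increase \<alpha> K t \<ge> 0"
  by (simp add: rate_increase_def)

text \<open>Before round 2 the rate is frozen at that of round 2, and from round 3 on its time
  factor decreases; only the passage from round 2 to round 3 can increase it.\<close>

lemma rate_increase_eq_0:
  assumes "0 \<le> \<alpha>" "K > 1" "t \<noteq> 2"
  shows "rate_increase \<alpha> K t = 0"
proof -
  have "positive_rate \<alpha> K (Suc t) \<le> positive_rate \<alpha> K t"
  proof (cases "t < 2")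
    case True
    then have "max (Suc t) 2 = max t 2" by auto
    then show ?thesis by (simp only: positive_rate_def)
  next
    case False
    then have t: "max t 2 = t" "max (Suc t) 2 = Suc t" "real t \<ge> 3" using assms by auto
    have "qlog (- \<alpha>) (real (Suc t)) / real (Suc t) \<le> qlog (- \<alpha>) (real t) / real t"
      using qlog_neg_div_antimono[OF assms(1) t(3)] by (simp add: add.commute)
    then show ?thesis
      unfolding positive_rate_def t using assms t(3) qlog_pos[OF assms(2), of "1 - \<alpha>"]
      by (subst (1 2) learning_rate_eq)
        (auto simp del: of_nat_Suc times_divide_eq_right intro!: mult_left_mono)
  qed
  then show ?thesis
    using positive_rate_pos[OF assms(2), of \<alpha> t] by (simp add: rate_increase_def)
qed

text \<open>The factor 2 is the round number weighting the increase in \<open>regret_sum_le\<close>;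
  the right-hand side is matched to the slack of the stability sum there.\<close>

lemma rate_increase_2_le:
  assumes "0 \<le> \<alpha>" "\<alpha> \<le> 1" "K > 1"
  shows "2 * rate_increase \<alpha> K 2 \<le> sqrt (qlog (- \<alpha>) 3 / 2)"
proof -
  let ?c = "qlog (- \<alpha>)"
  have c2: "?c 2 > 0" by (rule qlog_pos) simp
  have "positive_rate \<alpha> K 3 / positive_rate \<alpha> K 2 = sqrt ((?c 3 / 3) / (?c 2 / 2))"
    using assms qlog_pos[OF \<open>K > 1\<close>, of "1 - \<alpha>"]
    by (simp add: positive_rate_def learning_rate_eq real_sqrt_mult real_sqrt_divide)
  \<comment> \<open>\<open>qlog_neg_3_le\<close> bounds the radicand by 4 / 3 = 48 / 36, just below
    49 / 36.\<close>
  also have "\<dots> \<le> sqrt ((7 / 6)\<^sup>2)"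
    using qlog_neg_3_le[OF assms(1)] c2
    by (intro real_sqrt_le_mono) (simp add: field_simps power2_eq_square)
  finally have "positive_rate \<alpha> K 3 / positive_rate \<alpha> K 2 \<le> 7 / 6" by simp
  moreover have "Suc 2 = 3" by simp
  ultimately have "2 * rate_increase \<alpha> K 2 \<le> 1 / 3"
    unfolding rate_increase_def by (simp add: max_def mult.commute)
  also have "1 / 3 = sqrt ((1 / 3)\<^sup>2)" by simp
  also have "\<dots> \<le> sqrt (?c 3 / 2)"
  proof (intro real_sqrt_le_mono)
    have "3 powr (- 1) \<le> (3 powr (- \<alpha>) :: real)" using assms by (intro powr_mono) auto
    then show "(1 / 3)\<^sup>2 \<le> ?c 3 / 2"
      using powr_le_qlog_neg[OF assms(1), of 3] by (simp add: power2_eq_square powr_minus)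
  qed
  finally show ?thesis .
qed

section \<open>Optimality of the played weights and the bound on one run\<close>

lemma potential_uniform_le:
  fixes v :: "real ^ ('k::finite)"
  assumes "v \<in> prob_simplex" "0 \<le> \<alpha>" "\<alpha> = 0 \<Longrightarrow> \<forall>i. v $ i > 0"
  shows "potential \<alpha> (uniform_weights :: real ^ 'k) \<le> potential \<alpha> v"
  using ftrl_optimal_less[OF ftrl_optimal_uniform assms(1), where \<eta> = 1 and \<alpha> = \<alpha>] assms
  by (cases "v = uniform_weights") auto

lemma tsallis_inf_weights_optimal:
  fixes a :: "nat \<Rightarrow> 'k::finite"
  assumes "0 \<le> \<alpha>" "\<alpha> \<le> 1" "CARD('k) \<ge> 2" "t \<ge> 1"
  shows "ftrl_optimal \<alpha> (positive_rate \<alpha> (real CARD('k)) t) (cum_estimate \<alpha> a x (t - 1))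
    (tsallis_inf_weights \<alpha> a x t)"
proof (cases "t = 1")
  case True
  \<comment> \<open>The rate of round 1 is 0 because \<open>qlog (- \<alpha>) 1 = 0\<close>.\<close>
  have "tsallis_inf_weights \<alpha> a x 1 = uniform_weights"
    using assms tsallis_weights_zero_rate[of \<alpha> 0]
    by (simp add: tsallis_inf_weights_def learning_rate_eq)
  then show ?thesis using True ftrl_optimal_uniform by simp
next
  case False
  then have "max t 2 = t" using assms by simp
  then show ?thesis
    using ftrl_optimal_tsallis_weights[OF assms(1,2) positive_rate_pos[of "real CARD('k)" \<alpha> t]] assms
    by (simp add: tsallis_inf_weights_def positive_rate_def)
qed

lemma cum_estimate_nth:
  "cum_estimate \<alpha> a x T $ j = (\<Sum>t=1..T. (if a t = j then x t / tsallis_inf_weights \<alpha> a x t $ j else 0))"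
  by (induction T) (simp_all add: iw_estimate_def tsallis_inf_weights_def)

text \<open>The minimal objective value \<open>m t\<close>, with the potential shifted to vanish at
  the uniform point, is followed over time. \<open>ftrl_stability\<close> against the next weights
  links \<open>m t\<close> to \<open>m (Suc t)\<close> under the old rate; the last round is
  compared with v directly, so only rate changes after rounds before T enter.\<close>

lemma tsallis_inf_path_bound:
  fixes a :: "nat \<Rightarrow> 'k::finite" and v :: "real ^ 'k" and x :: "nat \<Rightarrow> real" and \<alpha> :: real
  defines "K \<equiv> real CARD('k)"
  defines "\<eta> \<equiv> positive_rate \<alpha> K" and "L \<equiv> cum_estimate \<alpha> a x" and "w \<equiv> tsallis_inf_weights \<alpha> a x"
  assumes \<alpha>: "0 \<le> \<alpha>" "\<alpha> \<le> 1" and card: "CARD('k) \<ge> 2"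
    and x: "\<And>t. t \<ge> 1 \<Longrightarrow> x t \<in> {0..1}"
    and v: "v \<in> prob_simplex" "\<And>i. v $ i > 0" and "T \<ge> 1"
  shows "(\<Sum>t=1..T. x t) \<le> v \<bullet> L T + (potential \<alpha> v - potential \<alpha> (uniform_weights :: real ^ 'k)) / \<eta> T +
    (\<Sum>t=1..T. \<eta> t / 2 * (w t $ a t) powr (- \<alpha>)) +
    (\<Sum>t=1..<T. rate_increase \<alpha> K t * (uniform_weights \<bullet> L t))"
proof -
  define u :: "real ^ 'k" where "u = uniform_weights"
  define Q where "Q v = potential \<alpha> v - potential \<alpha> u" for v :: "real ^ 'k"
  define m where "m t = w t \<bullet> L (t - 1) + Q (w t) / \<eta> t" for t
  define stab where "stab t = \<eta> t / 2 * (w t $ a t) powr (- \<alpha>)" for t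
  define r where "r t = rate_increase \<alpha> K t * (u \<bullet> L t)" for t
  have opt: "ftrl_optimal \<alpha> (\<eta> t) (L (t - 1)) (w t)" if "t \<ge> 1" for t
    unfolding \<eta>_def K_def L_def w_def using \<alpha> card that by (rule tsallis_inf_weights_optimal)
  have \<eta>: "\<eta> t > 0" for t unfolding \<eta>_def using card by (intro positive_rate_pos) (simp add: K_def)
  have w: "w t \<in> prob_simplex" "w t $ i > 0" if "t \<ge> 1" for t i
    using opt[OF that] by (auto simp: ftrl_optimal_def)
  have u: "u \<in> prob_simplex" "u $ i > 0" for i
    by (simp_all add: prob_simplex_def u_def)
  have L_Suc: "L t = L (t - 1) + iw_estimate (w t) (a t) (x t)" if "t \<ge> 1" for t
    using that by (cases t) (auto simp: L_def w_def tsallis_inf_weights_def)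
  have step: "m t + x t \<le> v \<bullet> L t + Q v / \<eta> t + stab t"
    if "t \<ge> 1" "v \<in> prob_simplex" "\<And>i. v $ i > 0" for t v
    using ftrl_stability[OF opt[OF that(1)] that(2), of "x t" "a t"] that \<alpha> \<eta>[of t] x[of t]
    by (simp add: L_Suc[OF that(1)] m_def stab_def Q_def diff_divide_distrib)
  have L_nonneg: "L t $ j \<ge> 0" for t j
    unfolding L_def cum_estimate_nth using x w
    by (intro sum_nonneg) (auto simp: w_def less_imp_le)
  have inner_nonneg: "y \<bullet> L t \<ge> 0" if "y \<in> prob_simplex" for y t
    using that L_nonneg by (auto simp: inner_vec_def prob_simplex_def intro!: sum_nonneg)
  have Q_nonneg: "Q (w t) \<ge> 0" if "t \<ge> 1" for t
    using w[OF that] \<alpha> by (simp add: Q_def u_def potential_uniform_le)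
  have m_Suc: "m t + x t - stab t - r t \<le> m (Suc t)" if "t \<ge> 1" for t
  proof -
    define A where "A = w (Suc t) \<bullet> L t"
    define q where "q = Q (w (Suc t))"
    have A: "A \<ge> 0" unfolding A_def by (intro inner_nonneg w) simp
    have q: "q \<ge> 0" unfolding q_def by (intro Q_nonneg) simp
    have m_eq: "m (Suc t) = A + q / \<eta> (Suc t)" by (simp add: m_def A_def q_def)
    have 1: "m t + x t - stab t \<le> A + q / \<eta> t"
      using step[OF that, of "w (Suc t)"] w[of "Suc t"] by (simp add: A_def q_def)
    show ?thesis
    proof (cases "\<eta> (Suc t) \<le> \<eta> t")
      \<comment> \<open>As q \<ge> 0, a smaller rate only enlarges the regularization term of the
        next round.\<close>
      case True
      then have "q / \<eta> t \<le> q / \<eta> (Suc t)" using q \<eta> by (intro divide_left_mono) auto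
      moreover have "r t \<ge> 0"
        unfolding r_def using inner_nonneg u by (simp add: rate_increase_nonneg)
      ultimately show ?thesis using 1 m_eq by linarith
    next
      case False
      define \<rho> where "\<rho> = \<eta> (Suc t) / \<eta> t"
      have \<rho>: "\<rho> \<ge> 1" using False \<eta>[of t] by (simp add: \<rho>_def)
      \<comment> \<open>The uniform point is a competitor with shifted potential 0. Returning to the
        old rate multiplies the regularization term by \<rho>, so the old-rate value is at most
        \<rho> times \<open>m (Suc t)\<close>, an excess of at most \<open>r t\<close>.\<close>
      have "m (Suc t) \<le> u \<bullet> L t"
        using ftrl_optimal_less[OF opt[of "Suc t"] u(1)] u(2) \<alpha> \<eta>[of "Suc t"]
        by (cases "u = w (Suc t)") (auto simp: m_def Q_def diff_divide_distrib)
      then have "(\<rho> - 1) * m (Suc t) \<le> (\<rho> - 1) * (u \<bullet> L t)"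
        using \<rho> by (intro mult_left_mono) auto
      also have "\<dots> = r t"
        using \<rho> by (simp add: r_def rate_increase_def \<rho>_def \<eta>_def max_def)
      finally have "\<rho> * m (Suc t) \<le> m (Suc t) + r t" by (simp add: algebra_simps)
      moreover have "\<rho> * m (Suc t) = \<rho> * A + q / \<eta> t"
        using \<eta>[of t] \<eta>[of "Suc t"] by (simp add: m_eq \<rho>_def field_simps)
      moreover have "A \<le> \<rho> * A" using A \<rho> by (simp add: mult_le_cancel_right1)
      ultimately show ?thesis using 1 by linarith
    qed
  qed
  have "(\<Sum>s=1..<t. x s) \<le> m t + (\<Sum>s=1..<t. stab s) + (\<Sum>s=1..<t. r s)" if "t \<ge> 1" for t
    using that
  proof (induction t rule: dec_induct)
    case base
    show ?case using Q_nonneg[of 1] \<eta>[of 1] by (simp add: m_def L_def)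
  next
    case (step t)
    then show ?case using m_Suc[of t] by simp
  qed
  from this[OF \<open>T \<ge> 1\<close>] step[OF \<open>T \<ge> 1\<close> v]
  have "(\<Sum>s=1..<T. x s) + x T \<le> v \<bullet> L T + Q v / \<eta> T + ((\<Sum>s=1..<T. stab s) + stab T) + (\<Sum>s=1..<T. r s)"
    by linarith
  moreover have "(\<Sum>s=1..T. f s) = (\<Sum>s=1..<T. f s) + f T" for f :: "nat \<Rightarrow> real"
    using \<open>T \<ge> 1\<close> by (simp add: sum.last_plus)
  ultimately show ?thesis
    by (simp add: Q_def stab_def r_def u_def)
qed

section \<open>The near-vertex comparator and the final sums\<close>

definition near_vertex :: "real \<Rightarrow> 'k \<Rightarrow> real ^ ('k::finite)" where
  "near_vertex T i = (\<chi> j. 1 / (T * real CARD('k)) + (if j = i then 1 - 1 / T else 0))"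

lemma near_vertex_simplex:
  fixes i :: "'k::finite"
  assumes "T \<ge> 1"
  shows "near_vertex T i \<in> prob_simplex" "near_vertex T i $ j > 0"
  using assms by (auto simp: prob_simplex_def near_vertex_def sum.distrib add_pos_nonneg)

lemma tsallis_potential_1 [simp]: "tsallis_potential \<alpha> 1 = 0"
  by (simp add: tsallis_potential_def)

lemma tsallis_potential_interior:
  assumes "z > 0" "\<alpha> \<noteq> 0" "\<alpha> \<noteq> 1"
  shows "\<alpha> * (1 - \<alpha>) * tsallis_potential \<alpha> z = 1 - \<alpha> - z powr \<alpha> + \<alpha> * z"
proof -
  have "z * z powr (\<alpha> - 1) = z powr \<alpha>" using assms by (simp add: powr_diff)
  then have "z * qlog (\<alpha> - 1) z = (z powr \<alpha> - z) / (\<alpha> - 1)"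
    using assms by (simp add: qlog_def algebra_simps)
  then show ?thesis using assms
    by (simp add: tsallis_potential_def) (simp add: qlog_def divide_simps, simp add: algebra_simps)
qed

text \<open>The left-hand side is the potential of the near-vertex point minus that of the uniform
  one. Convexity handles the large coordinate, a mixture of 1 and 1 / K, since the potential
  vanishes at 1; what remains is checked in closed form.\<close>

lemma potential_mix_le:
  fixes K T :: real
  assumes \<alpha>: "0 \<le> \<alpha>" "\<alpha> \<le> 1" and K: "K \<ge> 1" and T: "T \<ge> 1"
  shows "tsallis_potential \<alpha> (1 / (T * K) + (1 - 1 / T)) + (K - 1) * tsallis_potential \<alpha> (1 / (T * K))
    - K * tsallis_potential \<alpha> (1 / K) \<le> qlog (- \<alpha>) T * qlog (1 - \<alpha>) K"
proof -
  define a where "a = 1 / (T * K) + (1 - 1 / T)"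
  define h where "h = 1 - 1 / T"
  have a: "a > 0" using K T by (simp add: a_def add_pos_nonneg)
  have h: "h \<ge> 0" using T by (simp add: h_def)
  have Kinv: "1 / K > 0" "1 / (T * K) > 0" using K T by auto
  \<comment> \<open>Jensen's inequality from two tangent inequalities at a; the slope terms cancel
    because a = h + (1 - h) / K.\<close>
  have "h * potential_bregman \<alpha> 1 a + (1 - h) * potential_bregman \<alpha> (1 / K) a \<ge> 0"
    using \<alpha> a K T by (intro add_nonneg_nonneg mult_nonneg_nonneg potential_bregman_nonneg) (auto simp: h_def)
  moreover have "h * (1 - a) + (1 - h) * (1 / K - a) = 0"
    using K T by (simp add: h_def a_def field_simps)
  then have "qlog (\<alpha> - 1) a * (h * (1 - a) + (1 - h) * (1 / K - a)) = 0" by simp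
  then have "h * (qlog (\<alpha> - 1) a * (1 - a)) + (1 - h) * (qlog (\<alpha> - 1) a * (1 / K - a)) = 0"
    by (simp add: algebra_simps)
  ultimately have "tsallis_potential \<alpha> a \<le> (1 - h) * tsallis_potential \<alpha> (1 / K)"
    by (simp add: potential_bregman_def algebra_simps)
  moreover have "(K - 1) * (tsallis_potential \<alpha> (1 / (T * K)) - tsallis_potential \<alpha> (1 / K))
     - h * tsallis_potential \<alpha> (1 / K) \<le> qlog (- \<alpha>) T * qlog (1 - \<alpha>) K"
  proof -
    consider "\<alpha> = 0" | "\<alpha> = 1" | "\<alpha> > 0" "\<alpha> < 1" using \<alpha> by fastforce
    then show ?thesis
    proof cases
      case 1
      have eq: "tsallis_potential 0 z = z - 1 - ln z" if "z > 0" for z :: real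
        using that by (simp add: tsallis_potential_def qlog_def powr_minus_divide field_simps)
      have "(K - 1) * (tsallis_potential 0 (1 / (T * K)) - tsallis_potential 0 (1 / K))
         - h * tsallis_potential 0 (1 / K) = (K - 1) * ln T - h * ln K"
        unfolding eq[OF Kinv(1)] eq[OF Kinv(2)] using K T
        by (simp add: ln_div ln_mult h_def field_simps)
      moreover have "h * ln K \<ge> 0" using h K by simp
      ultimately show ?thesis using 1 K by (simp add: qlog_def mult.commute)
    next
      case 2
      have eq: "tsallis_potential 1 z = z * ln z - z + 1" if "z > 0" for z :: real
        using that by (simp add: tsallis_potential_def qlog_def)
      have "(K - 1) * (tsallis_potential 1 (1 / (T * K)) - tsallis_potential 1 (1 / K))
         - h * tsallis_potential 1 (1 / K) = h * ln K - (K - 1) * ln T / (T * K)"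
        unfolding eq[OF Kinv(1)] eq[OF Kinv(2)] using K T
        by (simp add: ln_div ln_mult h_def field_simps)
      moreover have "(K - 1) * ln T / (T * K) \<ge> 0" using K T by simp
      ultimately show ?thesis using 2 T by (simp add: qlog_def h_def powr_minus_divide)
    next
      case 3
      define s where "s = T powr (- \<alpha>)"
      define P where "P = K powr (- \<alpha>)"
      have s: "1 / T \<le> s"
        using powr_mono[of "-1" "- \<alpha>" T] T 3 by (simp add: s_def powr_minus_divide)
      have P: "P \<le> 1" using powr_mono[of "- \<alpha>" 0 K] K 3 by (simp add: P_def)
      have pw: "(1 / K) powr \<alpha> = P" "(1 / (T * K)) powr \<alpha> = s * P"
        using K T by (simp_all add: P_def s_def powr_divide powr_mult powr_minus_divide)
      have KP: "K powr (1 - \<alpha>) = K * P" using K by (simp add: P_def powr_diff powr_minus divide_inverse)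
      have e1: "\<alpha> * (1 - \<alpha>) * tsallis_potential \<alpha> (1 / K) = 1 - \<alpha> - P + \<alpha> / K"
        using tsallis_potential_interior[OF Kinv(1), of \<alpha>] 3 pw by simp
      have e2: "\<alpha> * (1 - \<alpha>) * tsallis_potential \<alpha> (1 / (T * K)) = 1 - \<alpha> - s * P + \<alpha> / (T * K)"
        using tsallis_potential_interior[OF Kinv(2), of \<alpha>] 3 pw by simp
      have e3: "\<alpha> * (1 - \<alpha>) * (qlog (- \<alpha>) T * qlog (1 - \<alpha>) K) = (1 - s) * (K * P - 1)"
        using 3 by (simp add: qlog_def KP flip: s_def) (simp add: field_simps)
      have "\<alpha> * (1 - \<alpha>) * ((K - 1) * (tsallis_potential \<alpha> (1 / (T * K)) - tsallis_potential \<alpha> (1 / K))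
         - h * tsallis_potential \<alpha> (1 / K)) =
         (K - 1) * (\<alpha> * (1 - \<alpha>) * tsallis_potential \<alpha> (1 / (T * K)) - \<alpha> * (1 - \<alpha>) * tsallis_potential \<alpha> (1 / K))
         - h * (\<alpha> * (1 - \<alpha>) * tsallis_potential \<alpha> (1 / K))"
        by (simp add: algebra_simps)
      \<comment> \<open>After clearing \<alpha> * (1 - \<alpha>) the two sides differ exactly by
        \<open>(1 - P) * (s - 1 / T)\<close>, a product of nonnegative factors.\<close>
      also have "\<dots> = (1 - s) * (K * P - 1) - (1 - P) * (s - 1 / T)"
        unfolding e1 e2 h_def using K T by (simp add: field_simps)
      also have "\<dots> \<le> (1 - s) * (K * P - 1)" using s P by simp
      also have "\<dots> = \<alpha> * (1 - \<alpha>) * (qlog (- \<alpha>) T * qlog (1 - \<alpha>) K)" using e3 by simp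
      finally show ?thesis using 3 by (simp add: mult_le_cancel_left)
    qed
  qed
  ultimately show ?thesis unfolding a_def[symmetric] by (simp add: algebra_simps)
qed

lemma potential_near_vertex_le:
  fixes i :: "'k::finite"
  assumes "0 \<le> \<alpha>" "\<alpha> \<le> 1" "T \<ge> 1"
  shows "potential \<alpha> (near_vertex T i) - potential \<alpha> (uniform_weights :: real ^ 'k) \<le>
    qlog (- \<alpha>) T * qlog (1 - \<alpha>) (real CARD('k))"
proof -
  let ?K = "real CARD('k)"
  have "potential \<alpha> (near_vertex T i) =
    tsallis_potential \<alpha> (near_vertex T i $ i) +
    (\<Sum>j\<in>UNIV - {i}. tsallis_potential \<alpha> (near_vertex T i $ j))"
    unfolding potential_def by (intro sum.remove) auto
  also have "(\<Sum>j\<in>UNIV - {i}. tsallis_potential \<alpha> (near_vertex T i $ j)) =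
     (\<Sum>j\<in>UNIV - {i}. tsallis_potential \<alpha> (1 / (T * ?K)))"
    by (intro sum.cong) (auto simp: near_vertex_def)
  also have "\<dots> = (?K - 1) * tsallis_potential \<alpha> (1 / (T * ?K))"
    by (simp add: card_Diff_singleton of_nat_diff Suc_leI)
  finally show ?thesis
    using potential_mix_le[OF assms(1,2) _ assms(3), of ?K]
    by (simp add: potential_def near_vertex_def Suc_leI)
qed

section \<open>Elementary sums and the closing minimum\<close>

lemma sum_powr_le_card:
  fixes p :: "'k::finite \<Rightarrow> real"
  assumes "\<And>i. p i > 0" "(\<Sum>i\<in>UNIV. p i) = 1" "0 \<le> \<alpha>" "\<alpha> \<le> 1"
  shows "(\<Sum>i\<in>UNIV. p i powr (1 - \<alpha>)) \<le> real CARD('k) powr \<alpha>"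
proof (cases "\<alpha> = 1")
  case True
  then show ?thesis using assms(1) by (simp add: less_imp_neq[symmetric])
next
  case False
  let ?K = "real CARD('k)"
  \<comment> \<open>Jensen's inequality through tangents at 1 / K, whose linear terms sum to
    0.\<close>
  have "(\<Sum>i\<in>UNIV. qlog (1 - \<alpha>) (p i)) \<le>
      (\<Sum>i\<in>(UNIV :: 'k set). qlog (1 - \<alpha>) (1 / ?K) + (1 / ?K) powr (1 - \<alpha> - 1) * (p i - 1 / ?K))"
    using assms by (intro sum_mono qlog_tangent) auto
  also have "\<dots> = ?K * qlog (1 - \<alpha>) (1 / ?K)"
    using assms(2) by (simp add: sum.distrib sum_subtractf flip: sum_distrib_left)
  finally have "((\<Sum>i\<in>UNIV. p i powr (1 - \<alpha>)) - ?K) / (1 - \<alpha>) \<le>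
      (?K * (1 / ?K) powr (1 - \<alpha>) - ?K) / (1 - \<alpha>)"
    using False by (simp add: qlog_def sum_subtractf right_diff_distrib flip: sum_divide_distrib)
  then have "(\<Sum>i\<in>UNIV. p i powr (1 - \<alpha>)) \<le> ?K * (1 / ?K) powr (1 - \<alpha>)"
    using False assms(4) by (simp add: divide_le_cancel)
  also have "\<dots> = ?K powr \<alpha>"
    by (simp add: powr_divide powr_diff)
  finally show ?thesis .
qed

text \<open>Each term is at most sqrt t - sqrt (t - 1), so the sum telescopes. Starting at 3 retains
  the term sqrt 2.\<close>

lemma sum_inverse_sqrt_le:
  assumes "T \<ge> 2"
  shows "(\<Sum>t=3..T. 1 / (2 * sqrt (real t))) \<le> sqrt (real T) - sqrt 2"
  using assms
proof (induction T rule: dec_induct)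
  case (step n)
  have "1 / (2 * sqrt (real (Suc n))) \<le> sqrt (real (Suc n)) - sqrt (real n)"
  proof -
    have "(sqrt (real (Suc n)) - sqrt (real n)) * (sqrt (real (Suc n)) + sqrt (real n)) = 1"
      by (simp add: algebra_simps)
    moreover have "(sqrt (real (Suc n)) - sqrt (real n)) * (sqrt (real (Suc n)) + sqrt (real n))
        \<le> (sqrt (real (Suc n)) - sqrt (real n)) * (2 * sqrt (real (Suc n)))"
      by (intro mult_left_mono) auto
    ultimately show ?thesis by (simp add: divide_le_eq)
  qed
  then show ?case using step by simp
qed simp

text \<open>The penalty is exactly half of the right-hand side. The stability sum falls short of the
  other half by at least \<open>D * (sqrt (?c T) * (sqrt 2 / 2))\<close>, and this pays for the rate
  increase.\<close>

lemma regret_sum_le: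
  fixes K :: real and T :: nat
  assumes \<alpha>: "0 \<le> \<alpha>" "\<alpha> \<le> 1" and K: "K \<ge> 2" and T: "T \<ge> 2"
  shows "qlog (- \<alpha>) (real T) * qlog (1 - \<alpha>) K / positive_rate \<alpha> K T +
     (\<Sum>t=1..T. positive_rate \<alpha> K t / 2 * K powr \<alpha>) +
     (\<Sum>t=1..<T. rate_increase \<alpha> K t * real t) \<le>
     2 * sqrt (K powr \<alpha> * qlog (1 - \<alpha>) K * qlog (- \<alpha>) (real T) * real T)"
proof -
  let ?c = "\<lambda>t :: nat. qlog (- \<alpha>) (real t)"
  define B where "B = qlog (1 - \<alpha>) K"
  define D where "D = sqrt (K powr \<alpha> * B)"
  define k where "k = sqrt (K powr \<alpha>)"
  define b where "b = sqrt B"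
  have B: "B > 0" using K qlog_pos[of K] by (simp add: B_def)
  have D1: "D \<ge> 1" using powr_mult_qlog_ge[of \<alpha> K] \<alpha> K by (simp add: D_def B_def)
  have k: "k > 0" "k\<^sup>2 = K powr \<alpha>" using K by (simp_all add: k_def)
  have b: "b > 0" "b\<^sup>2 = B" using B by (simp_all add: b_def)
  have D: "D = k * b" by (simp add: D_def k_def b_def real_sqrt_mult)
  have c_pos: "?c t > 0" if "t \<ge> 2" for t using that by (intro qlog_pos) auto
  have c_mono: "sqrt (?c t) \<le> sqrt (?c T)" if "t \<ge> 1" "t \<le> T" for t
    using that by (intro real_sqrt_le_mono qlog_mono) auto
  have rate: "positive_rate \<alpha> K t = b / k * (sqrt (?c t) / sqrt (real t))" if "t \<ge> 2" for t
    using that K by (simp add: positive_rate_def max_absorb1 learning_rate_eq k_def b_def B_def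
        real_sqrt_mult real_sqrt_divide powr_minus real_sqrt_inverse divide_inverse)
  have rate': "positive_rate \<alpha> K t / 2 * K powr \<alpha> = D * (sqrt (?c t) * (1 / (2 * sqrt (real t))))"
    if "t \<ge> 2" for t
    unfolding rate[OF that] k(2)[symmetric] D using k(1) that by (simp add: power2_eq_square field_simps)
  have penalty: "?c T * B / positive_rate \<alpha> K T = D * (sqrt (?c T) * sqrt (real T))"
  proof -
    have "?c T = sqrt (?c T) * sqrt (?c T)" using c_pos[OF T] by simp
    then have "?c T * B = sqrt (?c T) * sqrt (?c T) * b\<^sup>2" using b by simp
    then show ?thesis
      unfolding rate[OF T] D using k b c_pos[OF T] T by (simp add: power2_eq_square field_simps)
  qed
  have rate1: "positive_rate \<alpha> K (Suc 0) = positive_rate \<alpha> K 2"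
    by (simp add: positive_rate_def max_def)
  have sum3: "(\<Sum>t=3..T. positive_rate \<alpha> K t / 2 * K powr \<alpha>) =
      (\<Sum>t=3..T. D * (sqrt (?c t) * (1 / (2 * sqrt (real t)))))"
    by (intro sum.cong refl rate') auto
  \<comment> \<open>Rounds 1 and 2 share one rate and together contribute a multiple of 1 / sqrt 2,
    less than the sqrt 2 gained by starting the integral comparison at 3.\<close>
  have split: "{1..T} = insert 1 (insert 2 {3..T})" using T by auto
  have "(\<Sum>t=1..T. positive_rate \<alpha> K t / 2 * K powr \<alpha>) =
     2 * (positive_rate \<alpha> K 2 / 2 * K powr \<alpha>) + (\<Sum>t=3..T. positive_rate \<alpha> K t / 2 * K powr \<alpha>)"
    unfolding split using rate1 by simp
  also have "\<dots> = D * (sqrt (?c 2) / sqrt 2) + (\<Sum>t=3..T. D * (sqrt (?c t) * (1 / (2 * sqrt (real t)))))"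
    using rate'[of 2] sum3 by simp
  also have "\<dots> \<le> D * (sqrt (?c T) / sqrt 2) + (\<Sum>t=3..T. D * (sqrt (?c T) * (1 / (2 * sqrt (real t)))))"
    using D1 T by (intro add_mono mult_left_mono divide_right_mono sum_mono mult_right_mono c_mono) auto
  also have "\<dots> = D * (sqrt (?c T) * (1 / sqrt 2 + (\<Sum>t=3..T. 1 / (2 * sqrt (real t)))))"
    by (simp add: sum_distrib_left algebra_simps)
  also have "\<dots> \<le> D * (sqrt (?c T) * (1 / sqrt 2 + (sqrt (real T) - sqrt 2)))"
    using D1 T c_pos[OF T] sum_inverse_sqrt_le[OF T]
    by (intro mult_left_mono add_left_mono) auto
  also have "1 / sqrt 2 = sqrt 2 / 2" by (simp add: real_div_sqrt field_simps)
  finally have stab: "(\<Sum>t=1..T. positive_rate \<alpha> K t / 2 * K powr \<alpha>) \<le>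
      D * (sqrt (?c T) * sqrt (real T)) - D * (sqrt (?c T) * (sqrt 2 / 2))"
    by (simp add: algebra_simps)
  have incr: "(\<Sum>t=1..<T. rate_increase \<alpha> K t * real t) \<le> D * (sqrt (?c T) * (sqrt 2 / 2))"
  proof (cases "T = 2")
    case True
    then have "(\<Sum>t=1..<T. rate_increase \<alpha> K t * real t) = 0"
      using \<alpha> K by (intro sum.neutral) (auto simp: rate_increase_eq_0)
    then show ?thesis using D1 c_pos[OF T] by simp
  next
    case False
    have "(\<Sum>t=1..<T. rate_increase \<alpha> K t * real t) = (\<Sum>t\<in>{2}. rate_increase \<alpha> K t * real t)"
      using False T \<alpha> K by (intro sum.mono_neutral_right) (auto simp: rate_increase_eq_0)
    also have "\<dots> \<le> sqrt (?c 3 / 2)"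
      using rate_increase_2_le[of \<alpha> K] \<alpha> K by (simp add: mult.commute)
    also have "\<dots> = sqrt (?c 3) * (sqrt 2 / 2)"
      by (simp add: real_sqrt_divide real_div_sqrt field_simps)
    also have "\<dots> \<le> sqrt (?c T) * (sqrt 2 / 2)"
      using False T by (intro mult_right_mono c_mono) auto
    also have "\<dots> \<le> D * (sqrt (?c T) * (sqrt 2 / 2))"
      using mult_right_mono[OF D1, of "sqrt (?c T) * (sqrt 2 / 2)"] c_pos[OF T] by simp
    finally show ?thesis .
  qed
  have "sqrt (K powr \<alpha> * B * ?c T * real T) = D * (sqrt (?c T) * sqrt (real T))"
    by (simp add: D_def real_sqrt_mult)
  then show ?thesis using penalty stab incr unfolding B_def by linarith
qed

text \<open>b is at most K / (1 - \<alpha>) and K * ln K, and c is at most 1 / \<alpha> and ln T;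
  three of the four products are K times the terms of the minimum. At an endpoint only the term with
  nonzero denominator survives.\<close>

lemma powr_mult_qlog_le_regret_factor:
  fixes K T :: nat
  assumes \<alpha>: "0 \<le> \<alpha>" "\<alpha> \<le> 1" and K: "K \<ge> 1" and T: "T \<ge> 1"
  shows "real K powr \<alpha> * qlog (1 - \<alpha>) (real K) * qlog (- \<alpha>) (real T) \<le> regret_factor \<alpha> K T * real K"
proof -
  define b where "b = real K powr \<alpha> * qlog (1 - \<alpha>) (real K)"
  define c where "c = qlog (- \<alpha>) (real T)"
  have pos: "b \<ge> 0" "c \<ge> 0"
    using qlog_mono[of 1 "real K" "1 - \<alpha>"] qlog_mono[of 1 "real T" "- \<alpha>"] K T
    by (auto simp: b_def c_def)
  have split: "real K powr \<alpha> * real K powr (1 - \<alpha>) = real K"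
    using K by (simp flip: powr_add)
  have b1: "b \<le> real K / (1 - \<alpha>)" if "\<alpha> < 1"
  proof -
    have "b = (real K - real K powr \<alpha>) / (1 - \<alpha>)"
      using that split by (simp add: b_def qlog_def right_diff_distrib)
    then show ?thesis using that by (simp add: divide_right_mono)
  qed
  have "b \<le> real K powr \<alpha> * (real K powr (1 - \<alpha>) * ln (real K))"
    unfolding b_def using \<alpha> K by (intro mult_left_mono qlog_le_powr_ln) auto
  then have b2: "b \<le> real K * ln (real K)" by (simp add: split flip: mult.assoc)
  have c1: "c \<le> 1 / \<alpha>" if "\<alpha> > 0"
    using that by (simp add: c_def qlog_def field_simps)
  have c2: "c \<le> ln (real T)" unfolding c_def using \<alpha> T by (intro qlog_le_ln) auto
  consider "\<alpha> = 0" | "\<alpha> = 1" | "\<alpha> > 0" "\<alpha> < 1" using \<alpha> by fastforce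
  then have "b * c \<le> regret_factor \<alpha> K T * real K"
  proof cases
    case 1
    have "b * c \<le> real K * ln (real T)"
      using b1 c2 pos 1 by (intro mult_mono) auto
    then show ?thesis using 1 by (simp add: regret_factor_def quot_inf_def mult.commute)
  next
    case 2
    have "b * c \<le> (real K * ln (real K)) * 1"
      using b2 c1 pos 2 by (intro mult_mono) auto
    then show ?thesis using 2 by (simp add: regret_factor_def quot_inf_def mult.commute)
  next
    case 3
    have "\<alpha> - \<alpha>\<^sup>2 = (1 - \<alpha>) * \<alpha>" by (simp add: power2_eq_square algebra_simps)
    with 3 have \<alpha>2: "\<alpha> - \<alpha>\<^sup>2 = (1 - \<alpha>) * \<alpha>" "\<alpha> - \<alpha>\<^sup>2 \<noteq> 0" by auto
    have "b * c \<le> real K / (1 - \<alpha>) * (1 / \<alpha>)" using b1 c1 pos 3 by (intro mult_mono) auto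
    moreover have "b * c \<le> (real K * ln (real K)) * (1 / \<alpha>)" using b2 c1 pos 3 by (intro mult_mono) auto
    moreover have "b * c \<le> real K / (1 - \<alpha>) * ln (real T)" using b1 c2 pos 3 by (intro mult_mono) auto
    ultimately show ?thesis
      using 3 \<alpha>2(2) by (simp add: regret_factor_def quot_inf_def min_def \<alpha>2(1)) (simp add: mult.commute)
  qed
  then show ?thesis by (simp add: b_def c_def)
qed

section \<open>Conditional expectations and expected regret\<close>

context sigma_finite_subalgebra
begin

text \<open>\<open>real_cond_exp\<close> subtracts the \<open>enn2real\<close> values of two
  nonnegative conditional expectations. For an indicator the negative part vanishes, and the bound 1
  excludes \<open>\<top>\<close>, so the conversion loses nothing.\<close>

lemma cond_exp_indicator_bounds:
  assumes A: "A \<in> sets M"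
  shows "AE x in M. 0 \<le> real_cond_exp M F (indicator A) x \<and> real_cond_exp M F (indicator A) x \<le> 1 \<and>
    ennreal (real_cond_exp M F (indicator A) x) = nn_cond_exp M F (\<lambda>x. ennreal (indicator A x)) x"
proof -
  have [measurable]: "A \<in> sets M" by (rule A)
  have "AE x in M. nn_cond_exp M F (\<lambda>x. ennreal (indicator A x)) x \<le> nn_cond_exp M F (\<lambda>_. 1) x"
    by (intro nn_cond_exp_mono) (auto simp: indicator_def)
  moreover have "AE x in M. (1 :: ennreal) = nn_cond_exp M F (\<lambda>_. 1) x"
    by (rule nn_cond_exp_F_meas) simp
  moreover have "AE x in M. (0 :: ennreal) = nn_cond_exp M F (\<lambda>_. 0) x"
    by (rule nn_cond_exp_F_meas) simp
  ultimately show ?thesis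
  proof eventually_elim
    case (elim x)
    let ?N = "nn_cond_exp M F (\<lambda>x. ennreal (indicator A x)) x"
    have "(\<lambda>x. ennreal (- indicator A x)) = (\<lambda>_. 0)"
      by (auto simp: ennreal_neg)
    then have eq: "real_cond_exp M F (indicator A) x = enn2real ?N"
      using elim by (simp add: real_cond_exp_def)
    have N: "?N \<le> 1" using elim by simp
    then have "?N < \<top>" using order_le_less_trans ennreal_one_less_top by blast
    then show ?case using N unfolding eq by (simp add: enn2real_leI)
  qed
qed

text \<open>
  Integrability of the product with the indicator is a conclusion rather than a hypothesis, since
  importance weights are unbounded.
\<close>

lemma integral_mult_indicator_cond_exp:
  assumes g[measurable]: "g \<in> borel_measurable F" and A: "A \<in> sets M"
    and nonneg: "AE x in M. 0 \<le> g x"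
    and int: "integrable M (\<lambda>x. g x * real_cond_exp M F (indicator A) x)"
  shows "integrable M (\<lambda>x. g x * indicator A x)"
    and "(\<integral>x. g x * indicator A x \<partial>M) = (\<integral>x. g x * real_cond_exp M F (indicator A) x \<partial>M)"
proof -
  have [measurable]: "A \<in> sets M" "g \<in> borel_measurable M"
    using A measurable_from_subalg[OF subalg g] by auto
  have "(\<integral>\<^sup>+x. ennreal (g x * indicator A x) \<partial>M) = (\<integral>\<^sup>+x. ennreal (g x) * ennreal (indicator A x) \<partial>M)"
    by (simp add: ennreal_mult'')
  also have "\<dots> = (\<integral>\<^sup>+x. ennreal (g x) * nn_cond_exp M F (\<lambda>x. ennreal (indicator A x)) x \<partial>M)"
    by (rule nn_cond_exp_intg[symmetric]) auto
  also have "\<dots> = (\<integral>\<^sup>+x. ennreal (g x * real_cond_exp M F (indicator A) x) \<partial>M)"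
    using cond_exp_indicator_bounds[OF A]
    by (intro nn_integral_cong_AE) (auto simp: ennreal_mult'')
  finally have eq: "(\<integral>\<^sup>+x. ennreal (g x * indicator A x) \<partial>M) =
    (\<integral>\<^sup>+x. ennreal (g x * real_cond_exp M F (indicator A) x) \<partial>M)" .
  have nn1: "AE x in M. 0 \<le> g x * indicator A x"
    using nonneg by eventually_elim simp
  have nn2: "AE x in M. 0 \<le> g x * real_cond_exp M F (indicator A) x"
    using nonneg cond_exp_indicator_bounds[OF A] by eventually_elim simp
  show "integrable M (\<lambda>x. g x * indicator A x)"
    using eq nn_integral_eq_integral[OF int nn2]
    by (intro integrableI_nn_integral_finite[OF _ nn1]) auto
  show "(\<integral>x. g x * indicator A x \<partial>M) = (\<integral>x. g x * real_cond_exp M F (indicator A) x \<partial>M)"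
    using eq integral_eq_nn_integral[OF _ nn1] integral_eq_nn_integral[OF _ nn2] by simp
qed

end

section \<open>Integrability and elementary regret bounds in a bandit game\<close>

context bandit_game
begin

definition arm_event :: "nat \<Rightarrow> 'k \<Rightarrow> 'a set" where
  "arm_event t i = {\<omega> \<in> space M. arm t \<omega> = i}"

text \<open>This version of the conditional probability is measurable for \<open>F t\<close> by
  construction. Using it in place of the weights, with which it agrees almost surely, avoids proving
  measurability of a chosen arg max.\<close>

definition arm_prob :: "nat \<Rightarrow> 'k \<Rightarrow> 'a \<Rightarrow> real" where
  "arm_prob t i = real_cond_exp M (F t) (indicator (arm_event t i))"

lemma sigma_finite_subalgebra_F: "sigma_finite_subalgebra M (F t)"
  by (intro finite_measure_subalgebra_is_sigma_finite finite_measure_subalgebra.intro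
      finite_measure_subalgebra_axioms.intro subalgebra_F) unfold_locales

lemma arm_event_sets [measurable]:
  assumes "t \<ge> 1"
  shows "arm_event t i \<in> sets M"
proof -
  have [measurable]: "arm t \<in> measurable M (count_space UNIV)"
    using measurable_from_subalg[OF subalgebra_F arm_measurable[OF assms]] .
  show ?thesis unfolding arm_event_def by measurable
qed

lemma loss_nth_measurable_F:
  assumes "t \<ge> 1"
  shows "(\<lambda>\<omega>. loss t \<omega> $ i) \<in> borel_measurable (F t)"
  by (rule measurable_compose[OF loss_measurable[OF assms]])
    (intro borel_measurable_continuous_onI continuous_intros)

lemma loss_nth_integrable:
  assumes "t \<ge> 1"
  shows "integrable M (\<lambda>\<omega>. loss t \<omega> $ i)"
  using measurable_from_subalg[OF subalgebra_F loss_nth_measurable_F[OF assms]] loss_bounds[OF assms]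
  by (intro integrable_const_bound[where B = 1]) auto

lemma loss_arm_eq_sum:
  assumes "\<omega> \<in> space M"
  shows "loss t \<omega> $ arm t \<omega> = (\<Sum>i\<in>UNIV. loss t \<omega> $ i * indicator (arm_event t i) \<omega>)"
  using assms by (simp add: arm_event_def indicator_def if_distrib cong: if_cong)

lemma loss_arm_integrable:
  assumes "t \<ge> 1"
  shows "integrable M (\<lambda>\<omega>. loss t \<omega> $ arm t \<omega>)"
proof -
  have "integrable M (\<lambda>\<omega>. \<Sum>i\<in>UNIV. loss t \<omega> $ i * indicator (arm_event t i) \<omega>)"
    using loss_nth_integrable[OF assms] arm_event_sets[OF assms]
    by (intro Bochner_Integration.integrable_sum integrable_real_mult_indicator) auto
  then show ?thesis
    using loss_arm_eq_sum by (subst Bochner_Integration.integrable_cong) auto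
qed

lemma expected_loss_bounds:
  assumes "t \<ge> 1"
  shows "(\<integral>\<omega>. loss t \<omega> $ i \<partial>M) \<in> {0..1}"
  using loss_nth_integrable[OF assms] loss_bounds[OF assms]
  by (auto intro!: integral_nonneg_AE integral_le_const AE_I2)

text \<open>The minimum over the finitely many arms is attained, so it suffices to compete with one
  fixed arm.\<close>

lemma pseudo_regret_eq:
  obtains i where "pseudo_regret M loss arm T =
    (\<integral>\<omega>. (\<Sum>t=1..T. loss t \<omega> $ arm t \<omega>) \<partial>M) - (\<Sum>t=1..T. \<integral>\<omega>. loss t \<omega> $ i \<partial>M)"
proof -
  let ?G = "\<lambda>i. \<integral>\<omega>. (\<Sum>t=1..T. loss t \<omega> $ i) \<partial>M"
  have "Min (range ?G) \<in> range ?G" by (intro Min_in) auto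
  then obtain i where "Min (range ?G) = ?G i" by (rule rangeE)
  moreover have "?G i = (\<Sum>t=1..T. \<integral>\<omega>. loss t \<omega> $ i \<partial>M)"
    using loss_nth_integrable by (intro Bochner_Integration.integral_sum) auto
  ultimately show ?thesis by (intro that[of i]) (simp add: pseudo_regret_def)
qed

lemma pseudo_regret_le_horizon: "pseudo_regret M loss arm T \<le> real T"
proof -
  obtain i where i: "pseudo_regret M loss arm T =
    (\<integral>\<omega>. (\<Sum>t=1..T. loss t \<omega> $ arm t \<omega>) \<partial>M) - (\<Sum>t=1..T. \<integral>\<omega>. loss t \<omega> $ i \<partial>M)"
    by (rule pseudo_regret_eq)
  have "(\<Sum>t=1..T. loss t \<omega> $ arm t \<omega>) \<le> real T" if "\<omega> \<in> space M" for \<omega>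
    using sum_mono[of "{1..T}" "\<lambda>t. loss t \<omega> $ arm t \<omega>" "\<lambda>_. 1"] loss_bounds that by simp
  then have "(\<integral>\<omega>. (\<Sum>t=1..T. loss t \<omega> $ arm t \<omega>) \<partial>M) \<le> real T"
    using loss_arm_integrable by (intro integral_le_const AE_I2) auto
  moreover have "(\<Sum>t=1..T. \<integral>\<omega>. loss t \<omega> $ i \<partial>M) \<ge> 0"
    using expected_loss_bounds by (intro sum_nonneg) auto
  ultimately show ?thesis using i by linarith
qed

lemma pseudo_regret_single_arm:
  assumes "CARD('k) = 1"
  shows "pseudo_regret M loss arm T = 0"
proof -
  obtain i where i: "pseudo_regret M loss arm T =
    (\<integral>\<omega>. (\<Sum>t=1..T. loss t \<omega> $ arm t \<omega>) \<partial>M) - (\<Sum>t=1..T. \<integral>\<omega>. loss t \<omega> $ i \<partial>M)"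
    by (rule pseudo_regret_eq)
  have "arm t \<omega> = i" for t \<omega>
    using assms by (metis UNIV_I card_1_singletonE singletonD)
  then show ?thesis
    using i loss_nth_integrable by (simp add: Bochner_Integration.integral_sum)
qed

end

section \<open>The algorithm in expectation\<close>

context tsallis_inf_game
begin

abbreviation weights :: "'a \<Rightarrow> nat \<Rightarrow> real ^ 'k" where
  "weights \<omega> \<equiv> tsallis_inf_weights \<alpha> (\<lambda>s. arm s \<omega>) (\<lambda>s. loss s \<omega> $ arm s \<omega>)"

text \<open>Rounds are countable and arms finite, so a single null set serves all of them and the
  bound for one run applies outside it.\<close>

lemma AE_arm_prob:
  "AE \<omega> in M. \<forall>t\<ge>1. \<forall>i. arm_prob t i \<omega> = weights \<omega> t $ i"
proof -
  have "AE \<omega> in M. t \<ge> 1 \<longrightarrow> (\<forall>i\<in>UNIV. arm_prob t i \<omega> = weights \<omega> t $ i)" for t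
  proof (cases "t \<ge> 1")
    case True
    have "AE \<omega> in M. \<forall>i\<in>UNIV. arm_prob t i \<omega> = weights \<omega> t $ i"
      using arm_distribution[OF True] unfolding arm_prob_def arm_event_def
      by (intro AE_finite_allI) auto
    then show ?thesis by eventually_elim simp
  qed simp
  then have "AE \<omega> in M. \<forall>t. t \<ge> 1 \<longrightarrow> (\<forall>i\<in>UNIV. arm_prob t i \<omega> = weights \<omega> t $ i)"
    by (subst AE_all_countable) auto
  then show ?thesis by simp
qed

definition loss_estimate :: "nat \<Rightarrow> 'k \<Rightarrow> 'a \<Rightarrow> real" where
  "loss_estimate t i \<omega> = loss t \<omega> $ i / arm_prob t i \<omega> * indicator (arm_event t i) \<omega>"

definition inverse_weight :: "nat \<Rightarrow> 'k \<Rightarrow> 'a \<Rightarrow> real" where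
  "inverse_weight t i \<omega> = arm_prob t i \<omega> powr (- \<alpha>) * indicator (arm_event t i) \<omega>"

lemma arm_prob_measurable_F: "arm_prob t i \<in> borel_measurable (F t)"
  by (simp add: arm_prob_def)

text \<open>Conditioning on \<open>F t\<close> replaces the indicator of arm i by its probability p.
  This cancels the denominator of the loss estimate, and turns p^(-\<alpha>) into p^(1 - \<alpha>),
  to be summed by \<open>sum_powr_le_card\<close>.\<close>

lemma expected_estimates:
  assumes \<alpha>: "0 \<le> \<alpha>" "\<alpha> \<le> 1" and card: "CARD('k) \<ge> 2" and t: "t \<ge> 1"
  shows "integrable M (loss_estimate t i)"
    and "(\<integral>\<omega>. loss_estimate t i \<omega> \<partial>M) = (\<integral>\<omega>. loss t \<omega> $ i \<partial>M)"
    and "integrable M (inverse_weight t i)"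
    and "(\<Sum>i\<in>UNIV. \<integral>\<omega>. inverse_weight t i \<omega> \<partial>M) \<le> real CARD('k) powr \<alpha>"
proof -
  interpret sub: sigma_finite_subalgebra M "F t" by (rule sigma_finite_subalgebra_F)
  have [measurable]: "arm_prob t i \<in> borel_measurable M" for i
    by (rule measurable_from_subalg[OF subalgebra_F arm_prob_measurable_F])
  have [measurable]: "arm_prob t i \<in> borel_measurable (F t)" "(\<lambda>\<omega>. loss t \<omega> $ i) \<in> borel_measurable (F t)" for i
    using arm_prob_measurable_F loss_nth_measurable_F[OF t] by auto
  have prob: "AE \<omega> in M. \<forall>i. 0 < arm_prob t i \<omega>"
    "AE \<omega> in M. (\<Sum>i\<in>UNIV. arm_prob t i \<omega>) = 1"
    using AE_arm_prob by (eventually_elim,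
      use tsallis_inf_weights_optimal[OF \<alpha> card t] t in \<open>auto simp: ftrl_optimal_def prob_simplex_def\<close>)+
  have prob_le: "AE \<omega> in M. arm_prob t i \<omega> \<le> 1" for i
    using sub.cond_exp_indicator_bounds[OF arm_event_sets[OF t, of i]] by (auto simp: arm_prob_def)
  have loss_eq: "AE \<omega> in M. loss t \<omega> $ i / arm_prob t i \<omega> * arm_prob t i \<omega> = loss t \<omega> $ i" for i
    using prob(1) by eventually_elim (simp add: less_imp_neq[symmetric])
  have "AE \<omega> in M. 0 \<le> loss t \<omega> $ i / arm_prob t i \<omega>"
    using prob(1) AE_space
    by eventually_elim (use loss_bounds[OF t] in \<open>auto simp: less_imp_le intro!: divide_nonneg_nonneg\<close>)
  moreover have "integrable M (\<lambda>\<omega>. loss t \<omega> $ i / arm_prob t i \<omega> * arm_prob t i \<omega>)"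
    using loss_nth_integrable[OF t, of i] loss_eq[of i]
    by (subst integrable_cong_AE[OF _ _ loss_eq]) auto
  ultimately have *: "integrable M (loss_estimate t i)"
    "(\<integral>\<omega>. loss_estimate t i \<omega> \<partial>M) = (\<integral>\<omega>. loss t \<omega> $ i / arm_prob t i \<omega> * arm_prob t i \<omega> \<partial>M)"
    using sub.integral_mult_indicator_cond_exp[of "\<lambda>\<omega>. loss t \<omega> $ i / arm_prob t i \<omega>" "arm_event t i"]
      arm_event_sets[OF t, of i]
    by (auto simp: loss_estimate_def [abs_def] arm_prob_def [symmetric])
  show "integrable M (loss_estimate t i)" by (rule *)
  have "(\<integral>\<omega>. loss t \<omega> $ i / arm_prob t i \<omega> * arm_prob t i \<omega> \<partial>M) = (\<integral>\<omega>. loss t \<omega> $ i \<partial>M)"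
    using loss_nth_integrable[OF t, of i] loss_eq[of i] by (intro integral_cong_AE) auto
  then show "(\<integral>\<omega>. loss_estimate t i \<omega> \<partial>M) = (\<integral>\<omega>. loss t \<omega> $ i \<partial>M)" using * by simp
  have pow_eq: "AE \<omega> in M. arm_prob t i \<omega> powr (- \<alpha>) * arm_prob t i \<omega> = arm_prob t i \<omega> powr (1 - \<alpha>)" for i
    using prob(1)
    by eventually_elim (auto simp: powr_diff powr_minus_divide abs_of_pos)
  have pow_int: "integrable M (\<lambda>\<omega>. arm_prob t i \<omega> powr (1 - \<alpha>))" for i
  proof (rule integrable_const_bound[where B = 1])
    show "AE \<omega> in M. norm (arm_prob t i \<omega> powr (1 - \<alpha>)) \<le> 1"
      using prob(1) prob_le[of i]
      by eventually_elim (use \<alpha> in \<open>auto simp: less_imp_le powr_le1\<close>)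
  qed measurable
  have "integrable M (\<lambda>\<omega>. arm_prob t i \<omega> powr (- \<alpha>) * arm_prob t i \<omega>)" for i
    using pow_int[of i] by (subst integrable_cong_AE[OF _ _ pow_eq]) auto
  then have **: "integrable M (inverse_weight t i)"
    "(\<integral>\<omega>. inverse_weight t i \<omega> \<partial>M) = (\<integral>\<omega>. arm_prob t i \<omega> powr (- \<alpha>) * arm_prob t i \<omega> \<partial>M)" for i
    using sub.integral_mult_indicator_cond_exp[of "\<lambda>\<omega>. arm_prob t i \<omega> powr (- \<alpha>)" "arm_event t i"]
      arm_event_sets[OF t, of i]
    by (auto simp: inverse_weight_def [abs_def] arm_prob_def [symmetric])
  show "integrable M (inverse_weight t i)" by (rule **)
  have "(\<Sum>i\<in>UNIV. \<integral>\<omega>. inverse_weight t i \<omega> \<partial>M) =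
      (\<Sum>i\<in>UNIV. \<integral>\<omega>. arm_prob t i \<omega> powr (1 - \<alpha>) \<partial>M)"
    unfolding ** by (intro sum.cong refl integral_cong_AE pow_eq) measurable
  also have "\<dots> = (\<integral>\<omega>. (\<Sum>i\<in>UNIV. arm_prob t i \<omega> powr (1 - \<alpha>)) \<partial>M)"
    using pow_int by (subst Bochner_Integration.integral_sum) auto
  also have "\<dots> \<le> real CARD('k) powr \<alpha>"
    using pow_int
  proof (intro integral_le_const Bochner_Integration.integrable_sum)
    show "AE \<omega> in M. (\<Sum>i\<in>UNIV. arm_prob t i \<omega> powr (1 - \<alpha>)) \<le> real CARD('k) powr \<alpha>"
      using prob by eventually_elim (use \<alpha> in \<open>auto intro: sum_powr_le_card\<close>)
  qed auto
  finally show "(\<Sum>i\<in>UNIV. \<integral>\<omega>. inverse_weight t i \<omega> \<partial>M) \<le> real CARD('k) powr \<alpha>" .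
qed

text \<open>The bound for one run is integrated. Since v is deterministic, unbiasedness turns
  estimated into true expected losses; losses at most 1 bound the uniform distribution's expected
  cumulative loss by t.\<close>

lemma expected_regret_bound:
  fixes v :: "real ^ 'k" and T :: nat
  defines "K \<equiv> real CARD('k)"
  assumes \<alpha>: "0 \<le> \<alpha>" "\<alpha> \<le> 1" and card: "CARD('k) \<ge> 2" and T: "T \<ge> 1"
    and v: "v \<in> prob_simplex" "\<And>i. v $ i > 0"
  shows "(\<integral>\<omega>. (\<Sum>t=1..T. loss t \<omega> $ arm t \<omega>) \<partial>M) \<le>
    (\<Sum>i\<in>UNIV. v $ i * (\<Sum>t=1..T. \<integral>\<omega>. loss t \<omega> $ i \<partial>M)) +
    (potential \<alpha> v - potential \<alpha> (uniform_weights :: real ^ 'k)) / positive_rate \<alpha> K T +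
    (\<Sum>t=1..T. positive_rate \<alpha> K t / 2 * K powr \<alpha>) +
    (\<Sum>t=1..<T. rate_increase \<alpha> K t * real t)"
proof -
  define \<eta> where "\<eta> = positive_rate \<alpha> K"
  define Q where "Q = (potential \<alpha> v - potential \<alpha> (uniform_weights :: real ^ 'k)) / \<eta> T"
  define R where "R \<omega> = (\<Sum>i\<in>UNIV. v $ i * (\<Sum>t=1..T. loss_estimate t i \<omega>)) + Q +
    (\<Sum>t=1..T. \<eta> t / 2 * (\<Sum>i\<in>UNIV. inverse_weight t i \<omega>)) +
    (\<Sum>t=1..<T. rate_increase \<alpha> K t * (\<Sum>i\<in>UNIV. 1 / K * (\<Sum>s=1..t. loss_estimate s i \<omega>)))" for \<omega>
  have \<eta>: "\<eta> t > 0" for t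
    unfolding \<eta>_def using card by (intro positive_rate_pos) (simp add: K_def)
  have path: "AE \<omega> in M. (\<Sum>t=1..T. loss t \<omega> $ arm t \<omega>) \<le> R \<omega>"
    using AE_arm_prob AE_space
  proof eventually_elim
    case (elim \<omega>)
    let ?L = "cum_estimate \<alpha> (\<lambda>s. arm s \<omega>) (\<lambda>s. loss s \<omega> $ arm s \<omega>)"
    have L: "?L t $ i = (\<Sum>s=1..t. loss_estimate s i \<omega>)" for t i
      unfolding cum_estimate_nth using elim
      by (intro sum.cong) (auto simp: loss_estimate_def arm_event_def)
    have w: "weights \<omega> t $ arm t \<omega> powr (- \<alpha>) = (\<Sum>i\<in>UNIV. inverse_weight t i \<omega>)" if "t \<ge> 1" for t
      using elim that
      by (simp add: inverse_weight_def arm_event_def indicator_def if_distrib cong: if_cong)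
    have "(\<Sum>t=1..T. loss t \<omega> $ arm t \<omega>) \<le> v \<bullet> ?L T + Q +
      (\<Sum>t=1..T. \<eta> t / 2 * (weights \<omega> t $ arm t \<omega>) powr (- \<alpha>)) +
      (\<Sum>t=1..<T. rate_increase \<alpha> K t * (uniform_weights \<bullet> ?L t))"
      unfolding Q_def \<eta>_def K_def using loss_bounds elim
      by (intro tsallis_inf_path_bound \<alpha> card v T) auto
    also have "\<dots> = R \<omega>"
      unfolding R_def by (simp add: w inner_vec_def L K_def)
    finally show ?case .
  qed
  note int = expected_estimates[OF \<alpha> card]
  have R_int: "has_bochner_integral M R
    ((\<Sum>i\<in>UNIV. v $ i * (\<Sum>t=1..T. \<integral>\<omega>. loss t \<omega> $ i \<partial>M)) + Q +
    (\<Sum>t=1..T. \<eta> t / 2 * (\<Sum>i\<in>UNIV. \<integral>\<omega>. inverse_weight t i \<omega> \<partial>M)) +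
    (\<Sum>t=1..<T. rate_increase \<alpha> K t * (\<Sum>i\<in>UNIV. 1 / K * (\<Sum>s=1..t. \<integral>\<omega>. loss s \<omega> $ i \<partial>M))))"
    unfolding R_def [abs_def]
  proof (intro has_bochner_integral_add has_bochner_integral_sum has_bochner_integral_mult_right)
    show "has_bochner_integral M (\<lambda>_. Q) Q" by (simp add: has_bochner_integral_iff prob_space)
  qed (use int in \<open>auto simp: has_bochner_integral_iff\<close>)
  have "(\<integral>\<omega>. (\<Sum>t=1..T. loss t \<omega> $ arm t \<omega>) \<partial>M) \<le> (\<integral>\<omega>. R \<omega> \<partial>M)"
    using path R_int loss_arm_integrable by (intro integral_mono_AE) (auto simp: has_bochner_integral_iff)
  also have "(\<integral>\<omega>. R \<omega> \<partial>M) = (\<Sum>i\<in>UNIV. v $ i * (\<Sum>t=1..T. \<integral>\<omega>. loss t \<omega> $ i \<partial>M)) + Q +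
    (\<Sum>t=1..T. \<eta> t / 2 * (\<Sum>i\<in>UNIV. \<integral>\<omega>. inverse_weight t i \<omega> \<partial>M)) +
    (\<Sum>t=1..<T. rate_increase \<alpha> K t * (\<Sum>i\<in>UNIV. 1 / K * (\<Sum>s=1..t. \<integral>\<omega>. loss s \<omega> $ i \<partial>M)))"
    using R_int by (rule has_bochner_integral_integral_eq)
  also have "\<dots> \<le> (\<Sum>i\<in>UNIV. v $ i * (\<Sum>t=1..T. \<integral>\<omega>. loss t \<omega> $ i \<partial>M)) + Q +
    (\<Sum>t=1..T. \<eta> t / 2 * K powr \<alpha>) + (\<Sum>t=1..<T. rate_increase \<alpha> K t * real t)"
  proof (intro add_mono order_refl sum_mono mult_left_mono)
    show "(\<Sum>i\<in>UNIV. \<integral>\<omega>. inverse_weight t i \<omega> \<partial>M) \<le> K powr \<alpha>" if "t \<in> {1..T}" for t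
      using int(4) that by (simp add: K_def)
    show "(\<Sum>i\<in>UNIV. 1 / K * (\<Sum>s=1..t. \<integral>\<omega>. loss s \<omega> $ i \<partial>M)) \<le> real t" for t
    proof -
      have "(\<Sum>s=1..t. \<integral>\<omega>. loss s \<omega> $ i \<partial>M) \<le> real t" for i
        using sum_mono[of "{1..t}" "\<lambda>s. \<integral>\<omega>. loss s \<omega> $ i \<partial>M" "\<lambda>_. 1"] expected_loss_bounds by simp
      then have "(\<Sum>i\<in>UNIV. 1 / K * (\<Sum>s=1..t. \<integral>\<omega>. loss s \<omega> $ i \<partial>M)) \<le> (\<Sum>i\<in>(UNIV :: 'k set). 1 / K * real t)"
        by (intro sum_mono mult_left_mono) (auto simp: K_def)
      then show ?thesis by (simp add: K_def)
    qed
  qed (use \<eta> in \<open>auto simp: less_imp_le rate_increase_nonneg\<close>)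
  finally show ?thesis unfolding Q_def \<eta>_def .
qed

lemma pseudo_regret_le:
  assumes \<alpha>: "0 \<le> \<alpha>" "\<alpha> \<le> 1" and card: "CARD('k) \<ge> 2" and T: "T \<ge> 2"
  shows "pseudo_regret M loss arm T \<le> 1 +
    2 * sqrt (real CARD('k) powr \<alpha> * qlog (1 - \<alpha>) (real CARD('k)) * qlog (- \<alpha>) (real T) * real T)"
proof -
  let ?K = "real CARD('k)"
  obtain i where i: "pseudo_regret M loss arm T =
    (\<integral>\<omega>. (\<Sum>t=1..T. loss t \<omega> $ arm t \<omega>) \<partial>M) - (\<Sum>t=1..T. \<integral>\<omega>. loss t \<omega> $ i \<partial>M)"
    by (rule pseudo_regret_eq)
  define G where "G j = (\<Sum>t=1..T. \<integral>\<omega>. loss t \<omega> $ j \<partial>M)" for j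
  have G: "0 \<le> G j" "G j \<le> real T" for j
    using sum_mono[of "{1..T}" "\<lambda>s. \<integral>\<omega>. loss s \<omega> $ j \<partial>M" "\<lambda>_. 1"] expected_loss_bounds
    by (auto simp: G_def intro!: sum_nonneg)
  let ?v = "near_vertex (real T) i"
  have v: "?v \<in> prob_simplex" "?v $ j > 0" for j
    using near_vertex_simplex[of "real T" i] T by auto
  have "?v $ j * G j = G j / (real T * ?K) + (if j = i then (1 - 1 / real T) * G i else 0)" for j
    by (simp add: near_vertex_def distrib_right)
  then have "(\<Sum>j\<in>UNIV. ?v $ j * G j) = (\<Sum>j\<in>UNIV. G j / (real T * ?K)) + (1 - 1 / real T) * G i"
    by (simp add: sum.distrib)
  \<comment> \<open>The uniform part has weight 1 / T and every \<open>G j\<close> is at most T: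
    this is the additive 1 of the theorem.\<close>
  also have "(\<Sum>j\<in>UNIV. G j / (real T * ?K)) \<le> (\<Sum>j\<in>(UNIV :: 'k set). real T / (real T * ?K))"
    using G by (intro sum_mono divide_right_mono) auto
  also have "\<dots> = 1" using T by simp
  also have "(1 - 1 / real T) * G i \<le> G i" using G(1)[of i] T by (simp add: mult_left_le_one_le)
  finally have near: "(\<Sum>j\<in>UNIV. ?v $ j * G j) \<le> 1 + G i" by simp
  have "(potential \<alpha> ?v - potential \<alpha> (uniform_weights :: real ^ 'k)) / positive_rate \<alpha> ?K T \<le>
     qlog (- \<alpha>) (real T) * qlog (1 - \<alpha>) ?K / positive_rate \<alpha> ?K T"
    using potential_near_vertex_le[OF \<alpha>, of "real T" i] positive_rate_pos[of ?K \<alpha> T] card T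
    by (intro divide_right_mono) auto
  moreover have "T \<ge> 1" "?K \<ge> 2" using T card by auto
  ultimately show ?thesis
    using expected_regret_bound[OF \<alpha> card \<open>T \<ge> 1\<close> v] near i regret_sum_le[OF \<alpha> \<open>?K \<ge> 2\<close> T]
    unfolding G_def by linarith
qed

end

theorem theorem3:
  fixes M :: "'a measure" and F :: "nat \<Rightarrow> 'a measure"
    and loss :: "nat \<Rightarrow> 'a \<Rightarrow> real ^ ('k::finite)" and arm :: "nat \<Rightarrow> 'a \<Rightarrow> 'k"
    and \<alpha> :: real and T :: nat
  assumes "0 \<le> \<alpha>" and "\<alpha> \<le> 1"
    and "tsallis_inf_game M F loss arm \<alpha>"
    and "T \<ge> 1"
  shows "pseudo_regret M loss arm T
           \<le> 2 * sqrt (regret_factor \<alpha> CARD('k) T * real CARD('k) * real T) + 1"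
proof -
  interpret tsallis_inf_game M F loss arm \<alpha> by fact
  let ?K = "real CARD('k)"
  let ?c = "?K powr \<alpha> * qlog (1 - \<alpha>) ?K * qlog (- \<alpha>) (real T)"
  have card: "CARD('k) \<ge> 1" by (simp add: Suc_leI)
  have "?c \<ge> 0"
    using qlog_mono[of 1 ?K "1 - \<alpha>"] qlog_mono[of 1 "real T" "- \<alpha>"] card assms by simp
  moreover have "?c \<le> regret_factor \<alpha> CARD('k) T * ?K"
    using powr_mult_qlog_le_regret_factor[OF assms(1,2) card assms(4)] .
  ultimately have sqrt_le: "0 \<le> sqrt (?c * real T)"
    "sqrt (?c * real T) \<le> sqrt (regret_factor \<alpha> CARD('k) T * ?K * real T)"
    by (auto intro!: mult_right_mono)
  \<comment> \<open>With one arm all rates vanish, but so does the regret; with one round the regret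
    is at most 1. Otherwise K > 1 makes the modified rates positive.\<close>
  consider "CARD('k) = 1" | "T = 1" | "CARD('k) \<ge> 2" "T \<ge> 2"
    using card assms(4) by linarith
  then have "pseudo_regret M loss arm T \<le> 2 * sqrt (?c * real T) + 1"
  proof cases
    case 1
    then show ?thesis using pseudo_regret_single_arm[OF 1, of T] sqrt_le by linarith
  next
    case 2
    then show ?thesis using pseudo_regret_le_horizon[of T] sqrt_le by simp
  next
    case 3
    then show ?thesis using pseudo_regret_le[OF assms(1,2) 3] by linarith
  qed
  then show ?thesis using sqrt_le by linarith
qed

end
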